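(* Let $\theta_\infty,\kappa_0\in\mathbb{C}$ and consider the fourth Painlevé equation $$\frac{dx}{dz}=-x^2+2xy+2xz-2\theta_\infty,\qquad \frac{dy}{dz}=-y^2+2xy-2yz-2\kappa_0,$$ and the coordinates $Y_1=yx^{-1}$, $Z_1=zx^{-1}$, $\varepsilon_1=x^{-2}$. There exists a local analytic transformation $(y,z)\mapsto(\tilde y,\tilde z)$ (with $\tilde x=x$ unchanged), defined near $(Y_1,Z_1,\varepsilon_1)=(0,0,0)$, such that the fourth Painlevé equation is transformed into the integrable system $$\frac{d\tilde x}{d\tilde z}=-\tilde x^2,\qquad \frac{d\tilde y}{d\tilde z}=2\tilde x\tilde y-2\kappa_0.$$
   Context: The coordinates $(Y_1,Z_1,\varepsilon_1)$ are inhomogeneous coordinates of the weighted projective space $\mathbb{C}P^3(1,1,1,2)$, related to $(x,y,z)$ by $x=\varepsilon_1^{-1/2}$, $y=Y_1\varepsilon_1^{-1/2}$, $z=Z_1\varepsilon_1^{-1/2}$. A "local analytic transformation $(y,z)\mapsto(\tilde y,\tilde z)$ defined near $(Y_1,Z_1,\varepsilon_1)=(0,0,0)$" means: a biholomorphic map $(Y_1,Z_1,\varepsilon_1)\mapsto(u_1,v_1,\varepsilon_1)$ defined in a neighborhood of the origin, fixing the origin and leaving $\varepsilon_1$ unchanged, with $\tilde x=x$, $\tilde y=u_1x$, $\tilde z=v_1x$. "Is transformed into" means that solutions of the fourth Painlevé equation lying in this neighborhood (with $\varepsilon_1\neq0$) are mapped to solutions of the displayed system, $\tilde z$ being the new independent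 variable. *)

theory Defs
  imports "HOL-Complex_Analysis.Complex_Analysis"
begin

text \<open>
  Holomorphy of maps between open subsets of complex coordinate spaces: Frechet differentiability
  (over the reals, as provided by the library) with a complex-linear derivative at every point.
\<close>

definition holomorphic_map_on ::
    "(complex ^ 'n::finite \<Rightarrow> complex ^ 'm::finite) \<Rightarrow> (complex ^ 'n) set \<Rightarrow> bool" where
  "holomorphic_map_on f U \<longleftrightarrow>
     open U \<and> (\<forall>p\<in>U. \<exists>f'. (f has_derivative f') (at p) \<and> Vector_Spaces.linear (*s) (*s) f')"

definition biholomorphic_map ::
    "(complex ^ 'n::finite) set \<Rightarrow> (complex ^ 'n) set \<Rightarrow> (complex ^ 'n \<Rightarrow> complex ^ 'n) \<Rightarrow> bool" where
  "biholomorphic_map U V \<Phi> \<longleftrightarrow>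
     bij_betw \<Phi> U V \<and> holomorphic_map_on \<Phi> U \<and> holomorphic_map_on (inv_into U \<Phi>) V"

definition PIV_solution ::
    "complex \<Rightarrow> complex \<Rightarrow> complex set \<Rightarrow> (complex \<Rightarrow> complex) \<Rightarrow> (complex \<Rightarrow> complex) \<Rightarrow> bool" where
  "PIV_solution \<theta> \<kappa> D x y \<longleftrightarrow> open D \<and>
     (\<forall>z\<in>D. (x has_field_derivative - (x z)\<^sup>2 + 2 * x z * y z + 2 * x z * z - 2 * \<theta>) (at z) \<and>
            (y has_field_derivative - (y z)\<^sup>2 + 2 * x z * y z - 2 * y z * z - 2 * \<kappa>) (at z))"

definition integrable_solution ::
    "complex \<Rightarrow> complex set \<Rightarrow> (complex \<Rightarrow> complex) \<Rightarrow> (complex \<Rightarrow> complex) \<Rightarrow> bool" where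
  "integrable_solution \<kappa> D x y \<longleftrightarrow> open D \<and>
     (\<forall>z\<in>D. (x has_field_derivative - (x z)\<^sup>2) (at z) \<and>
            (y has_field_derivative 2 * x z * y z - 2 * \<kappa>) (at z))"

text \<open>
  The inhomogeneous coordinates \<open>(Y\<^sub>1, Z\<^sub>1, \<epsilon>\<^sub>1)\<close> of the point \<open>(x, y, z)\<close>; meaningful
  for \<open>x \<noteq> 0\<close> only.
\<close>

definition coords1 :: "complex \<Rightarrow> complex \<Rightarrow> complex \<Rightarrow> complex ^ 3" where
  "coords1 x y z = vector [y / x, z / x, 1 / x\<^sup>2]"

definition new_y :: "(complex ^ 3 \<Rightarrow> complex ^ 3) \<Rightarrow> complex \<Rightarrow> complex \<Rightarrow> complex \<Rightarrow> complex" where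
  "new_y \<Phi> x y z = \<Phi> (coords1 x y z) $ 1 * x"

definition new_z :: "(complex ^ 3 \<Rightarrow> complex ^ 3) \<Rightarrow> complex \<Rightarrow> complex \<Rightarrow> complex \<Rightarrow> complex" where
  "new_z \<Phi> x y z = \<Phi> (coords1 x y z) $ 2 * x"

text \<open>
  A solution of the fourth Painleve equation running inside \<open>U\<close> is mapped to the curve
  \<open>z \<mapsto> (x z, yt z, zt z)\<close>. Taking \<open>zt\<close> as the new independent variable
  requires inverting it, which is in general possible only locally: around each point of the
  domain, \<open>zt\<close> is injective on some neighbourhood \<open>W\<close> with open image, and on
  that image the functions \<open>x\<close> and \<open>yt\<close>, expressed through \<open>zt\<close>, solve the
  integrable system.
\<close>

definition transforms_PIV_to_integrable ::
    "complex \<Rightarrow> complex \<Rightarrow> (complex ^ 3) set \<Rightarrow> (complex ^ 3 \<Rightarrow> complex ^ 3) \<Rightarrow> bool" where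
  "transforms_PIV_to_integrable \<theta> \<kappa> U \<Phi> \<longleftrightarrow>
     (\<forall>D x y. PIV_solution \<theta> \<kappa> D x y \<longrightarrow>
        (\<forall>z\<in>D. x z \<noteq> 0 \<and> coords1 (x z) (y z) z \<in> U) \<longrightarrow>
        (let yt = (\<lambda>z. new_y \<Phi> (x z) (y z) z);
             zt = (\<lambda>z. new_z \<Phi> (x z) (y z) z)
         in \<forall>z\<^sub>0\<in>D. \<exists>W. open W \<and> z\<^sub>0 \<in> W \<and> W \<subseteq> D \<and> inj_on zt W \<and>
              integrable_solution \<kappa> (zt ` W) (x \<circ> inv_into W zt) (yt \<circ> inv_into W zt)))"

end

theory Submission
  imports Defs
begin

text \<open>
  Write \<open>k = 2\<kappa>\<^sub>0\<close>. With the time \<open>s\<close> normalised by \<open>d\<epsilon>/ds = 2\<epsilon>\<close>, the integrable system is the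
  linear field \<open>(3u - k\<epsilon>, v + \<epsilon>, 2\<epsilon>)\<close>, whose flow, where \<open>t = exp s\<close>, is a weighted dilation
  \<open>\<delta>\<^sub>t\<close>, and the task is to linearise the Painleve field at the origin. The eigenvalues 3, 1, 2 are
  resonant, but the Painleve property removes the obstruction. Along an orbit put
  \<open>Z\<^sub>1 = t Z(t)\<close>, \<open>Y\<^sub>1 = k\<epsilon> t\<^sup>2 + t\<^sup>3 P(t)\<close>, \<open>\<epsilon>\<^sub>1 = \<epsilon> t\<^sup>2\<close>; then \<open>(Z, P)\<close> satisfies an ordinary differential
  equation that is regular at \<open>t = 0\<close>, with free initial values \<open>Z(0) = v - \<epsilon>\<close> and \<open>P(0) = u - k\<epsilon>\<close>.
  For small data its power series solution converges beyond \<open>t = 1\<close>, and evaluation at \<open>t = 1\<close>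
  gives a holomorphic map \<open>F(u, v, \<epsilon>) = (k\<epsilon> + P(1), Z(1), \<epsilon>)\<close> which is the identity up to second
  order. Weighted homogeneity of the coefficients shows that \<open>F\<close> carries the linear field to the
  Painleve field, so the inverse of \<open>F\<close> is the required transformation.
\<close>

unbundle no Formal_Power_Series.fps_syntax

section \<open>Holomorphic maps of several complex variables\<close>

text \<open>Additivity comes with \<open>has_derivative\<close>, so homogeneity over the complex
  scalars is all that complex linearity adds.\<close>

definition complex_diff_on :: "(complex ^ 'n::finite \<Rightarrow> complex) \<Rightarrow> (complex ^ 'n) set \<Rightarrow> bool" where
  "complex_diff_on f S \<longleftrightarrow>
     (\<forall>w\<in>S. \<exists>f'. (f has_derivative f') (at w) \<and> (\<forall>c h. f' (c *s h) = c * f' h))"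

lemma complex_diff_on_const: "complex_diff_on (\<lambda>w. c) S"
  unfolding complex_diff_on_def by (intro ballI exI[of _ "\<lambda>_. 0"]) auto

lemma complex_diff_on_component: "complex_diff_on (\<lambda>w. w $ i) S"
  unfolding complex_diff_on_def
  by (intro ballI exI[of _ "\<lambda>h. h $ i"]) (auto intro!: derivative_eq_intros bounded_linear_imp_has_derivative bounded_linear_vec_nth)

lemma complex_diff_on_add:
  assumes "complex_diff_on f S" "complex_diff_on g S"
  shows "complex_diff_on (\<lambda>w. f w + g w) S"
  unfolding complex_diff_on_def
proof
  fix w assume "w \<in> S"
  then obtain f' g' where "(f has_derivative f') (at w)" "\<forall>c h. f' (c *s h) = c * f' h"
    "(g has_derivative g') (at w)" "\<forall>c h. g' (c *s h) = c * g' h"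
    using assms unfolding complex_diff_on_def by meson
  then show "\<exists>D. ((\<lambda>w. f w + g w) has_derivative D) (at w) \<and> (\<forall>c h. D (c *s h) = c * D h)"
    by (intro exI[of _ "\<lambda>h. f' h + g' h"] conjI has_derivative_add) (auto simp: distrib_left)
qed

lemma complex_diff_on_mult:
  assumes "complex_diff_on f S" "complex_diff_on g S"
  shows "complex_diff_on (\<lambda>w. f w * g w) S"
  unfolding complex_diff_on_def
proof
  fix w assume "w \<in> S"
  then obtain f' g' where "(f has_derivative f') (at w)" "\<forall>c h. f' (c *s h) = c * f' h"
    "(g has_derivative g') (at w)" "\<forall>c h. g' (c *s h) = c * g' h"
    using assms unfolding complex_diff_on_def by meson
  then show "\<exists>D. ((\<lambda>w. f w * g w) has_derivative D) (at w) \<and> (\<forall>c h. D (c *s h) = c * D h)"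
    by (intro exI[of _ "\<lambda>h. f w * g' h + f' h * g w"] conjI has_derivative_mult) (auto simp: algebra_simps)
qed

lemma complex_diff_on_cmult: "complex_diff_on f S \<Longrightarrow> complex_diff_on (\<lambda>w. c * f w) S"
  by (intro complex_diff_on_mult complex_diff_on_const)

lemma complex_diff_on_diff:
  "complex_diff_on f S \<Longrightarrow> complex_diff_on g S \<Longrightarrow> complex_diff_on (\<lambda>w. f w - g w) S"
  using complex_diff_on_add[of f S "\<lambda>w. - 1 * g w"] complex_diff_on_cmult[of g S "-1"] by simp

lemma complex_diff_on_sum:
  "(\<And>i. i \<in> A \<Longrightarrow> complex_diff_on (f i) S) \<Longrightarrow> complex_diff_on (\<lambda>w. \<Sum>i\<in>A. f i w) S"
  by (induction A rule: infinite_finite_induct) (auto intro: complex_diff_on_const complex_diff_on_add)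

lemma complex_diff_on_subset: "complex_diff_on f S \<Longrightarrow> T \<subseteq> S \<Longrightarrow> complex_diff_on f T"
  by (auto simp: complex_diff_on_def)

section \<open>Cauchy's estimate and series of holomorphic functions\<close>

lemma norm_vector_scalar_mult: "norm (c *s h) = norm c * norm (h :: complex ^ 'n::finite)"
  by (simp add: norm_vec_def norm_mult L2_set_right_distrib)

lemma has_derivative_vector_scalar_mult:
  "((\<lambda>t. t *s h) has_derivative (\<lambda>t. t *s (h :: complex ^ 'n::finite))) F"
proof (rule bounded_linear_imp_has_derivative, rule bounded_linear_intro)
  show "norm (x *s h) \<le> norm x * norm h" for x by (simp add: norm_vector_scalar_mult)
qed (auto simp: vec_eq_iff algebra_simps)

text \<open>Restriction of \<open>f\<close> to the complex line through \<open>w\<close> in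
  direction \<open>h\<close> reduces the bound to Cauchy's inequality in one variable.\<close>

lemma complex_diff_on_Cauchy_estimate:
  assumes f: "complex_diff_on f (ball w R)" and M: "\<And>v. v \<in> ball w R \<Longrightarrow> norm (f v) \<le> M"
    and R: "R > 0" and f': "(f has_derivative f') (at w)"
  shows "norm (f' h) \<le> 2 * M / R * norm h"
proof (cases "h = 0")
  case True
  then show ?thesis
    using linear_0[OF has_derivative_linear[OF f']] by simp
next
  case False
  \<comment> \<open>Half of \<open>R / norm h\<close> keeps the closed disc inside the open ball;
    this is the source of the factor 2 in the bound.\<close>
  define r where "r = R / (2 * norm h)"
  have r: "r > 0" using False R by (simp add: r_def)
  define \<phi> where "\<phi> = (\<lambda>t. f (w + t *s h))"
  have inb: "w + t *s h \<in> ball w R" if "norm t \<le> r" for t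
  proof -
    have "norm (t *s h) \<le> r * norm h"
      unfolding norm_vector_scalar_mult by (intro mult_right_mono that) auto
    also have "\<dots> = R / 2" using False by (simp add: r_def)
    also have "\<dots> < R" using R by simp
    finally show ?thesis by (simp add: dist_norm)
  qed
  have D: "(\<phi> has_derivative (\<lambda>d. g' (d *s h))) (at t)" if "(f has_derivative g') (at (w + t *s h))" for t g'
    unfolding \<phi>_def
    by (rule has_derivative_compose[where f = "\<lambda>t. w + t *s h" and g = f, OF _ that]) (auto intro!: derivative_eq_intros has_derivative_vector_scalar_mult)
  have "\<phi> field_differentiable (at t)" if t: "norm t \<le> r" for t
  proof -
    obtain g' where g': "(f has_derivative g') (at (w + t *s h))" "\<forall>c h. g' (c *s h) = c * g' h"
      using f inb[OF t] unfolding complex_diff_on_def by meson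
    have "(\<lambda>d. g' (d *s h)) = (*) (g' h)" using g'(2) by auto
    with D[OF g'(1)] show ?thesis unfolding field_differentiable_def has_field_derivative_def by metis
  qed
  then have hol: "\<phi> holomorphic_on cball 0 r"
    by (auto simp: holomorphic_on_def intro: field_differentiable_at_within)
  have "norm ((deriv ^^ 1) \<phi> 0) \<le> fact 1 * M / r ^ 1"
  proof (rule Cauchy_inequality)
    show "\<phi> holomorphic_on ball 0 r" using hol by (rule holomorphic_on_subset) auto
    show "continuous_on (cball 0 r) \<phi>" using hol by (rule holomorphic_on_imp_continuous_on)
    show "norm (\<phi> t) \<le> M" if "norm (0 - t) = r" for t
      unfolding \<phi>_def using that by (intro M inb) auto
  qed (fact r)
  moreover have "deriv \<phi> 0 = f' h"
  proof -
    obtain g' where g': "(f has_derivative g') (at w)" "\<forall>c h. g' (c *s h) = c * g' h"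
      using f R unfolding complex_diff_on_def by (meson centre_in_ball)
    have "g' = f'" using g'(1) f' by (rule has_derivative_unique)
    then have "(\<lambda>d. f' (d *s h)) = (*) (f' h)" using g'(2) by auto
    then have "(\<phi> has_field_derivative f' h) (at 0)"
      using D[of f' 0] f' by (simp add: has_field_derivative_def)
    then show ?thesis by (rule DERIV_imp_deriv)
  qed
  ultimately have "norm (f' h) \<le> M / r" by simp
  also have "\<dots> = 2 * M / R * norm h" by (simp add: r_def)
  finally show ?thesis .
qed

text \<open>Weierstrass' theorem: Cauchy's estimate dominates the derivatives by a summable series,
  so the sum may be differentiated termwise. Halving the radius leaves room for a ball of radius
  \<open>R\<close> around each point.\<close>

lemma complex_diff_on_suminf:
  fixes f :: "nat \<Rightarrow> complex ^ 'n::finite \<Rightarrow> complex"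
  assumes f: "\<And>n. complex_diff_on (f n) (ball 0 (2 * R))"
    and b: "\<And>n w. w \<in> ball 0 (2 * R) \<Longrightarrow> norm (f n w) \<le> b n" and "summable b" and R: "R > 0"
  shows "complex_diff_on (\<lambda>w. \<Sum>n. f n w) (ball 0 R)"
proof -
  have "\<forall>n. \<forall>w\<in>ball 0 (2 * R). \<exists>f'. (f n has_derivative f') (at w) \<and> (\<forall>c h. f' (c *s h) = c * f' h)"
    using f unfolding complex_diff_on_def by blast
  then obtain f' where f': "\<And>n w. w \<in> ball 0 (2 * R) \<Longrightarrow> (f n has_derivative f' n w) (at w)"
    "\<And>n w c h. w \<in> ball 0 (2 * R) \<Longrightarrow> f' n w (c *s h) = c * f' n w h"
    by metis
  have sub: "ball w R \<subseteq> ball 0 (2 * R)" if "w \<in> ball 0 R" for w :: "complex ^ 'n"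
  proof
    fix v assume "v \<in> ball w R"
    then show "v \<in> ball 0 (2 * R)"
      using that norm_triangle_ineq[of w "v - w"] by (simp add: dist_norm norm_minus_commute)
  qed
  have wS: "w \<in> ball 0 (2 * R)" if "w \<in> ball 0 R" for w :: "complex ^ 'n"
    using that R by auto
  define B where "B = (\<lambda>n. 2 * b n / R)"
  have fB: "norm (f' n w h) \<le> B n * norm h" if w: "w \<in> ball 0 R" for n and w h :: "complex ^ 'n"
    unfolding B_def
    by (rule complex_diff_on_Cauchy_estimate[OF complex_diff_on_subset[OF f sub[OF w]] b R f'(1)[OF wS[OF w]]])
      (use sub[OF w] in blast)
  have sB: "summable B" unfolding B_def using \<open>summable b\<close> by (intro summable_divide summable_mult)
  have sm: "summable (\<lambda>n. f' n w h)" if w: "w \<in> ball 0 R" for w h :: "complex ^ 'n"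
    by (rule summable_comparison_test'[OF summable_mult2[OF sB]]) (rule fB[OF w])
  define g' where "g' = (\<lambda>w h. \<Sum>n. f' n w h)"
  have unif: "\<forall>\<^sub>F n in sequentially. \<forall>w\<in>ball (0 :: complex ^ 'n) R. \<forall>h. norm ((\<Sum>i<n. f' i w h) - g' w h) \<le> e * norm (h :: complex ^ 'n)"
    if "e > 0" for e :: real
  proof -
    have "(\<lambda>n. (\<Sum>i. B (i + n))) \<longlonglongrightarrow> 0"
      by (rule suminf_exist_split2[OF sB])
    then have "\<forall>\<^sub>F n in sequentially. (\<Sum>i. B (i + n)) < e"
      using that by (rule order_tendstoD)
    then show ?thesis
    proof (eventually_elim, intro ballI allI)
      fix n and w h :: "complex ^ 'n" assume n: "(\<Sum>i. B (i + n)) < e" and w: "w \<in> ball 0 R"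
      have sB': "summable (\<lambda>i. B (i + n) * norm h)"
        by (intro summable_mult2 summable_ignore_initial_segment sB)
      have "norm ((\<Sum>i<n. f' i w h) - g' w h) = norm (\<Sum>i. f' (i + n) w h)"
        using suminf_split_initial_segment[OF sm[OF w], of h n] by (simp add: g'_def)
      also have "\<dots> \<le> (\<Sum>i. B (i + n) * norm h)"
        by (rule norm_suminf_le[OF _ sB']) (rule fB[OF w])
      also have "\<dots> = (\<Sum>i. B (i + n)) * norm h"
        by (rule suminf_mult2[symmetric, OF summable_ignore_initial_segment[OF sB]])
      also have "\<dots> \<le> e * norm h" using n by (intro mult_right_mono) auto
      finally show "norm ((\<Sum>i<n. f' i w h) - g' w h) \<le> e * norm h" .
    qed
  qed
  have s0: "summable (\<lambda>n. f n 0)"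
  proof (rule summable_comparison_test'[OF \<open>summable b\<close>])
    show "norm (f n 0) \<le> b n" for n by (rule b) (use R in simp)
  qed
  have D: "(f n has_derivative f' n w) (at w within ball 0 R)" if "w \<in> ball 0 R" for n w
    by (rule has_derivative_at_withinI[OF f'(1)[OF wS[OF that]]])
  have "\<exists>g. \<forall>w\<in>ball 0 R. (\<lambda>n. f n w) sums g w \<and> (g has_derivative g' w) (at w within ball 0 R)"
    using R by (intro has_derivative_series[where f' = f', OF convex_ball D unif _ summable_sums[OF s0]]) simp_all
  then obtain g where
    g: "\<forall>w\<in>ball 0 R. (\<lambda>n. f n w) sums g w \<and> (g has_derivative g' w) (at w within ball 0 R)" ..
  show ?thesis
    unfolding complex_diff_on_def
  proof
    fix w :: "complex ^ 'n" assume w: "w \<in> ball 0 R"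
    have "(g has_derivative g' w) (at w)"
      using bspec[OF g w] w by (simp add: at_within_open[OF w open_ball])
    then have "((\<lambda>w. \<Sum>n. f n w) has_derivative g' w) (at w)"
      by (rule has_derivative_transform_within_open[OF _ open_ball w])
        (metis g sums_unique)
    moreover have "g' w (c *s h) = c * g' w h" for c h
      unfolding g'_def using suminf_mult[OF sm[OF w]] by (simp add: f'(2)[OF wS[OF w]])
    ultimately show "\<exists>D. ((\<lambda>w. \<Sum>n. f n w) has_derivative D) (at w) \<and> (\<forall>c h. D (c *s h) = c * D h)"
      by blast
  qed
qed

section \<open>Vector-valued maps and inversion near the identity\<close>

lemma linear_vector_scaleI:
  fixes f :: "complex ^ 'n::finite \<Rightarrow> complex ^ 'm::finite"
  assumes "bounded_linear f" "\<And>c h. f (c *s h) = c *s f h"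
  shows "Vector_Spaces.linear (*s) (*s) f"
  using assms unfolding Vector_Spaces.linear_iff
  by (auto simp: vec.vector_space_axioms linear_simps)

lemma has_derivative_vecI:
  fixes F :: "'a::real_normed_vector \<Rightarrow> 'b::euclidean_space ^ 'n::finite"
  assumes "\<And>i. ((\<lambda>w. F w $ i) has_derivative f' i) (at w)"
  shows "(F has_derivative (\<lambda>h. \<chi> i. f' i h)) (at w)"
  unfolding has_derivative_componentwise_within[of F]
proof
  fix b :: "'b ^ 'n" assume "b \<in> Basis"
  then obtain i u where b: "b = axis i u" by (auto simp: Basis_vec_def)
  show "((\<lambda>x. F x \<bullet> b) has_derivative (\<lambda>x. (\<chi> i. f' i x) \<bullet> b)) (at w)"
    using has_derivative_inner_left[OF assms[of i], of u] by (simp add: b inner_axis)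
qed

lemma holomorphic_map_onI:
  fixes F :: "complex ^ 'n::finite \<Rightarrow> complex ^ 'm::finite"
  assumes "open U" and F: "\<And>i. complex_diff_on (\<lambda>w. F w $ i) U"
  shows "holomorphic_map_on F U"
  unfolding holomorphic_map_on_def
proof (intro conjI ballI)
  fix w assume w: "w \<in> U"
  have "\<forall>i. \<exists>f'. ((\<lambda>w. F w $ i) has_derivative f') (at w) \<and> (\<forall>c h. f' (c *s h) = c * f' h)"
    using F w unfolding complex_diff_on_def by blast
  then obtain f' where f': "\<And>i. ((\<lambda>w. F w $ i) has_derivative f' i) (at w)" "\<And>i c h. f' i (c *s h) = c * f' i h"
    by metis
  have D: "(F has_derivative (\<lambda>h. \<chi> i. f' i h)) (at w)"
    by (rule has_derivative_vecI) (rule f')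
  moreover have "Vector_Spaces.linear (*s) (*s) (\<lambda>h. \<chi> i. f' i h)"
    by (rule linear_vector_scaleI[OF has_derivative_bounded_linear[OF D]]) (simp add: vec_eq_iff f'(2))
  ultimately show "\<exists>f'. (F has_derivative f') (at w) \<and> Vector_Spaces.linear (*s) (*s) f'" by blast
qed fact

lemma holomorphic_map_on_component:
  assumes "holomorphic_map_on F U"
  shows "complex_diff_on (\<lambda>w. F w $ i) U"
  unfolding complex_diff_on_def
proof
  fix w assume "w \<in> U"
  then obtain F' where F': "(F has_derivative F') (at w)" "Vector_Spaces.linear (*s) (*s) F'"
    using assms unfolding holomorphic_map_on_def by blast
  have "((\<lambda>w. F w $ i) has_derivative (\<lambda>h. F' h $ i)) (at w)"
    using bounded_linear.has_derivative[OF bounded_linear_vec_nth F'(1)] .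
  moreover have "F' (c *s h) = c *s F' h" for c h
    using F'(2) unfolding Vector_Spaces.linear_iff by blast
  ultimately show "\<exists>f'. ((\<lambda>w. F w $ i) has_derivative f') (at w) \<and> (\<forall>c h. f' (c *s h) = c * f' h)"
    by (intro exI[of _ "\<lambda>h. F' h $ i"]) simp
qed

lemma norm_le_sum_norm_components: "norm (x :: complex ^ 'n::finite) \<le> (\<Sum>i\<in>UNIV. norm (x $ i))"
  unfolding norm_vec_def by (rule L2_set_le_sum) simp

text \<open>By Cauchy's estimate the deviation from the identity is Lipschitz with a small constant near
  the origin, so the map is injective there, and invariance of domain makes its image open.\<close>

lemma near_identity_biholomorphic:
  fixes F :: "complex ^ 'n::finite \<Rightarrow> complex ^ 'n"
  assumes F: "holomorphic_map_on F (ball 0 (2 * \<rho>))" and "\<rho> > 0"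
    and K: "\<forall>w\<in>ball 0 (2 * \<rho>). norm (F w - w) \<le> K * (norm w)\<^sup>2" "K \<ge> 0"
    and small: "real CARD('n) * (8 * K * \<rho>) \<le> 1 / 2"
  defines "V \<equiv> ball 0 \<rho>"
  shows "biholomorphic_map (F ` V) V (inv_into V F)"
    and "\<And>w. w \<in> V \<Longrightarrow> inv_into V F (F w) = w"
    and "\<And>w F' \<Phi>'. w \<in> V \<Longrightarrow> (F has_derivative F') (at w) \<Longrightarrow>
           (inv_into V F has_derivative \<Phi>') (at (F w)) \<Longrightarrow> \<Phi>' (F' h) = h"
proof -
  let ?U = "F ` V" and ?\<Phi> = "inv_into V F"
  have sub: "V \<subseteq> ball 0 (2 * \<rho>)" using \<open>\<rho> > 0\<close> by (auto simp: V_def)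
  have "open V" "convex V" by (auto simp: V_def)
  have "\<forall>w\<in>ball 0 (2 * \<rho>). \<exists>f'. (F has_derivative f') (at w) \<and> Vector_Spaces.linear (*s) (*s) f'"
    using F unfolding holomorphic_map_on_def by blast
  then obtain F' where F': "\<And>w. w \<in> ball 0 (2 * \<rho>) \<Longrightarrow> (F has_derivative F' w) (at w)"
    "\<And>w. w \<in> ball 0 (2 * \<rho>) \<Longrightarrow> Vector_Spaces.linear (*s) (*s) (F' w)" by metis
  have FV: "(F has_derivative F' w) (at w)" if "w \<in> V" for w using F'(1) that sub by blast
  have scale: "F' w (c *s h) = c *s F' w h" if "w \<in> V" for w c h
    using F'(2)[of w] that sub unfolding Vector_Spaces.linear_iff by blast
  \<comment> \<open>Cauchy's estimate on \<open>ball w \<rho>\<close> with the bound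
    \<open>K * (2 * \<rho>)\<^sup>2\<close> gives \<open>8 * K * \<rho> * norm h\<close> for each
    component. Adding the components brings in \<open>CARD('n)\<close>, and \<open>small\<close>
    makes the total one half.\<close>
  have contr: "norm (F' w h - h) \<le> 1 / 2 * norm h" if w: "w \<in> V" for w h
  proof -
    have sub': "ball w \<rho> \<subseteq> ball 0 (2 * \<rho>)"
    proof
      fix v assume "v \<in> ball w \<rho>"
      then show "v \<in> ball 0 (2 * \<rho>)"
        using w norm_triangle_ineq[of w "v - w"] by (simp add: V_def dist_norm norm_minus_commute)
    qed
    have "norm ((F' w h - h) $ i) \<le> 8 * K * \<rho> * norm h" for i
    proof -
      have "complex_diff_on (\<lambda>v. F v $ i - v $ i) (ball w \<rho>)"
        by (intro complex_diff_on_diff complex_diff_on_component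
            complex_diff_on_subset[OF holomorphic_map_on_component[OF F] sub'])
      moreover have "norm (F v $ i - v $ i) \<le> K * (2 * \<rho>)\<^sup>2" if "v \<in> ball w \<rho>" for v
      proof -
        have v: "v \<in> ball 0 (2 * \<rho>)" using that sub' by blast
        have "norm (F v $ i - v $ i) \<le> norm (F v - v)"
          using Finite_Cartesian_Product.norm_nth_le[of "F v - v" i] by simp
        also have "\<dots> \<le> K * (norm v)\<^sup>2" by (rule bspec[OF K(1) v])
        also have "\<dots> \<le> K * (2 * \<rho>)\<^sup>2" using v K(2) by (intro mult_left_mono power_mono) auto
        finally show ?thesis .
      qed
      moreover have "((\<lambda>v. F v $ i - v $ i) has_derivative (\<lambda>h. F' w h $ i - h $ i)) (at w)"
        by (intro has_derivative_diff bounded_linear.has_derivative[OF bounded_linear_vec_nth] FV[OF w] has_derivative_ident)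
      ultimately have "norm (F' w h $ i - h $ i) \<le> 2 * (K * (2 * \<rho>)\<^sup>2) / \<rho> * norm h"
        using \<open>\<rho> > 0\<close> by (intro complex_diff_on_Cauchy_estimate) auto
      then show ?thesis using \<open>\<rho> > 0\<close> by (simp add: power2_eq_square algebra_simps)
    qed
    then have "(\<Sum>i\<in>UNIV. norm ((F' w h - h) $ i)) \<le> real CARD('n) * (8 * K * \<rho> * norm h)"
      by (intro sum_bounded_above)
    also have "\<dots> \<le> 1 / 2 * norm h"
      using mult_right_mono[OF small, of "norm h"] by (simp add: mult.assoc)
    finally show ?thesis using norm_le_sum_norm_components[of "F' w h - h"] by linarith
  qed
  have inj': "inj (F' w)" if w: "w \<in> V" for w
    unfolding linear_injective_0[OF has_derivative_linear[OF FV[OF w]]]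
  proof (intro allI impI)
    fix h assume "F' w h = 0"
    then show "h = 0" using contr[OF w, of h] by simp
  qed
  have inj: "inj_on F V"
  proof (rule inj_onI)
    fix v w assume vw: "v \<in> V" "w \<in> V" "F v = F w"
    \<comment> \<open>If \<open>F v = F w\<close>, this difference of deviations has norm
      \<open>norm (v - w)\<close>, which the Lipschitz constant 1/2 permits only for
      \<open>v = w\<close>.\<close>
    have "norm ((F v - v) - (F w - w)) \<le> 1 / 2 * norm (v - w)"
    proof (rule differentiable_bound[OF \<open>convex V\<close> _ _ vw(1,2), where f' = "\<lambda>w h. F' w h - h"])
      show "((\<lambda>w. F w - w) has_derivative (\<lambda>h. F' w h - h)) (at w within V)" if "w \<in> V" for w
        by (intro has_derivative_diff has_derivative_ident has_derivative_at_withinI[OF FV[OF that]])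
      show "onorm (\<lambda>h. F' w h - h) \<le> 1 / 2" if "w \<in> V" for w
        by (rule onorm_bound) (use contr[OF that] in auto)
    qed
    moreover have "norm ((F v - v) - (F w - w)) = norm (v - w)"
      using vw(3) by (simp add: norm_minus_commute)
    ultimately show "v = w" by simp
  qed
  have cont: "continuous_on V F"
    using FV by (meson continuous_at_imp_continuous_on has_derivative_continuous)
  have "open ?U" using cont \<open>open V\<close> inj by (rule invariance_of_domain)
  show inv: "?\<Phi> (F w) = w" if "w \<in> V" for w using inj that by simp
  have deriv_inv: "\<exists>\<Phi>'. (?\<Phi> has_derivative \<Phi>') (at (F w)) \<and> (\<forall>h. \<Phi>' (F' w h) = h) \<and>
      Vector_Spaces.linear (*s) (*s) \<Phi>'" if w: "w \<in> V" for w
  proof -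
    obtain G where G: "linear G" "\<forall>x. G (F' w x) = x" "\<forall>x. F' w (G x) = x"
      using linear_injective_isomorphism[OF has_derivative_linear[OF FV[OF w]] inj'[OF w]] by blast
    have D: "(?\<Phi> has_derivative G) (at (F w))"
      using G(3) by (intro has_derivative_inverse_strong[OF \<open>open V\<close> w cont inv FV[OF w]]) auto
    have "G (c *s h) = c *s G h" for c h
      using G(2,3) scale[OF w, of c "G h"] by metis
    then have "Vector_Spaces.linear (*s) (*s) G"
      by (rule linear_vector_scaleI[OF has_derivative_bounded_linear[OF D]])
    then show ?thesis using D G(2) by blast
  qed
  show "\<Phi>' (D h) = h" if w: "w \<in> V" and "(F has_derivative D) (at w)" "(?\<Phi> has_derivative \<Phi>') (at (F w))"
    for w D \<Phi>'
    using deriv_inv[OF w] that(2,3) FV[OF w] has_derivative_unique by metis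
  have bij: "bij_betw ?\<Phi> ?U V" using inj by (simp add: bij_betw_inv_into inj_on_imp_bij_betw)
  \<comment> \<open>\<open>biholomorphic_map\<close> asks for holomorphy of the inverse of
    \<open>?\<Phi>\<close>, which on \<open>V\<close> is \<open>F\<close> itself.\<close>
  have "inv_into ?U ?\<Phi> w = F w" if "w \<in> V" for w
    using bij_betw_imp_inj_on[OF bij] inv[OF that] that by (metis image_eqI inv_into_f_f)
  then have inv2: "F w = inv_into ?U ?\<Phi> w" if "w \<in> V" for w using that by simp
  have "holomorphic_map_on (inv_into ?U ?\<Phi>) V"
    unfolding holomorphic_map_on_def
  proof (intro conjI ballI)
    fix w assume w: "w \<in> V"
    have "(inv_into ?U ?\<Phi> has_derivative F' w) (at w)"
      using FV[OF w] \<open>open V\<close> w inv2 by (rule has_derivative_transform_within_open)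
    then show "\<exists>f'. (inv_into ?U ?\<Phi> has_derivative f') (at w) \<and> Vector_Spaces.linear (*s) (*s) f'"
      using F'(2) w sub by blast
  qed fact
  moreover have "holomorphic_map_on ?\<Phi> ?U"
    unfolding holomorphic_map_on_def using \<open>open ?U\<close> deriv_inv by blast
  ultimately show "biholomorphic_map ?U V ?\<Phi>"
    using bij unfolding biholomorphic_map_def by blast
qed

section \<open>The regularised equation and its power series solution\<close>

unbundle no vec_syntax and Formal_Power_Series.fps_syntax

section \<open>Congruence of formal power series modulo a power of the variable\<close>

definition agree :: "nat \<Rightarrow> complex fps \<Rightarrow> complex fps \<Rightarrow> bool" where
  "agree n f g \<longleftrightarrow> (\<forall>m<n. f $ m = g $ m)"

lemma agree_add: "agree n f f' \<Longrightarrow> agree n g g' \<Longrightarrow> agree n (f + g) (f' + g')"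
  by (simp add: agree_def)

lemma agree_mult: "agree n f f' \<Longrightarrow> agree n g g' \<Longrightarrow> agree n (f * g) (f' * g')"
  by (auto simp: agree_def fps_mult_nth intro!: sum.cong)

lemma agree_refl: "agree n f f"
  by (simp add: agree_def)

lemma agree_XD: "agree n f f' \<Longrightarrow> agree n (fps_XD f) (fps_XD f')"
  by (simp add: agree_def fps_XD_nth)

text \<open>The order gained by integration is what makes the iteration below stabilise.\<close>

lemma agree_integral: "agree n f f' \<Longrightarrow> agree (Suc n) (fps_integral f c) (fps_integral f' c)"
  by (auto simp: agree_def fps_integral_def)

section \<open>A truncated weighted norm\<close>

text \<open>The weight 2 yields convergence beyond \<open>t = 1\<close>. The truncation keeps the
  norm finite before convergence is known and permits induction on \<open>N\<close>.\<close>

definition psum :: "nat \<Rightarrow> complex fps \<Rightarrow> real" where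
  "psum N f = (\<Sum>n\<le>N. norm (f $ n) * 2 ^ n)"

lemma psum_nonneg: "psum N f \<ge> 0"
  by (simp add: psum_def sum_nonneg)

lemma psum_add: "psum N (f + g) \<le> psum N f + psum N g"
  unfolding psum_def sum.distrib[symmetric]
  by (intro sum_mono) (metis distrib_right fps_add_nth mult_right_mono norm_triangle_ineq zero_le_numeral zero_le_power)

lemma psum_const: "psum N (fps_const c) = norm c"
proof -
  have "psum N (fps_const c) = (\<Sum>n\<in>{0}. norm (fps_const c $ n) * 2 ^ n)"
    unfolding psum_def by (rule sum.mono_neutral_right) auto
  then show ?thesis by simp
qed

text \<open>The Cauchy product runs over the triangle \<open>i + j \<le> N\<close>, which lies in
  the square covered by the product of the two sums.\<close>

lemma psum_mult: "psum N (f * g) \<le> psum N f * psum N g"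
proof -
  have "psum N (f * g) \<le> (\<Sum>n\<le>N. \<Sum>i\<le>n. (norm (f $ i) * 2 ^ i) * (norm (g $ (n - i)) * 2 ^ (n - i)))"
    unfolding psum_def
  proof (rule sum_mono)
    fix n
    have "norm ((f * g) $ n) \<le> (\<Sum>i\<le>n. norm (f $ i) * norm (g $ (n - i)))"
      by (auto simp: fps_mult_nth atLeast0AtMost norm_mult intro!: order_trans[OF norm_sum])
    then have "norm ((f * g) $ n) * 2 ^ n \<le> (\<Sum>i\<le>n. norm (f $ i) * norm (g $ (n - i))) * 2 ^ n"
      by (intro mult_right_mono) auto
    also have "\<dots> = (\<Sum>i\<le>n. (norm (f $ i) * 2 ^ i) * (norm (g $ (n - i)) * 2 ^ (n - i)))"
      unfolding sum_distrib_right
    proof (rule sum.cong, simp)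
      fix i assume "i \<in> {..n}"
      then have "(2::real) ^ n = 2 ^ i * 2 ^ (n - i)" by (simp flip: power_add)
      then show "norm (f $ i) * norm (g $ (n - i)) * 2 ^ n
          = (norm (f $ i) * 2 ^ i) * (norm (g $ (n - i)) * 2 ^ (n - i))" by simp
    qed
    finally show "norm ((f * g) $ n) * 2 ^ n
        \<le> (\<Sum>i\<le>n. (norm (f $ i) * 2 ^ i) * (norm (g $ (n - i)) * 2 ^ (n - i)))" .
  qed
  also have "\<dots> = (\<Sum>(i,j)\<in>{(i,j). i + j \<le> N}. (norm (f $ i) * 2 ^ i) * (norm (g $ j) * 2 ^ j))"
    by (simp add: sum.triangle_reindex_eq)
  also have "\<dots> \<le> (\<Sum>(i,j)\<in>{..N} \<times> {..N}. (norm (f $ i) * 2 ^ i) * (norm (g $ j) * 2 ^ j))"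
    by (intro sum_mono2) auto
  also have "\<dots> = psum N f * psum N g"
    by (simp add: psum_def sum_product sum.cartesian_product)
  finally show ?thesis .
qed

lemma psum_const_mult: "psum N (fps_const c * f) = norm c * psum N f"
  by (simp add: psum_def norm_mult sum_distrib_left mult.assoc)

lemma psum_X: "psum N fps_X \<le> 2"
proof -
  have "psum N fps_X = (\<Sum>n\<in>{..N} \<inter> {1}. norm ((fps_X::complex fps) $ n) * 2 ^ n)"
    unfolding psum_def by (rule sum.mono_neutral_right) (auto simp: fps_X_def)
  also have "\<dots> \<le> 2"
    by (cases "1 \<in> {..N}") auto
  finally show ?thesis .
qed

lemma psum_X_mult: "psum N (fps_X * f) \<le> 2 * psum N f"
  using psum_mult[of N fps_X f] mult_right_mono[OF psum_X psum_nonneg, of N N f] by linarith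

text \<open>A shift of coefficients by one place costs one weight factor 2, but the bound now
  reaches degree \<open>Suc N\<close>; this drives the later induction.\<close>

lemma psum_Suc_le:
  assumes "\<And>n. norm (f $ Suc n) \<le> norm (g $ n)" "f $ 0 = 0"
  shows "psum (Suc N) f \<le> 2 * psum N g"
proof -
  have "psum (Suc N) f = (\<Sum>n\<le>N. norm (f $ Suc n) * 2 ^ Suc n)"
    unfolding psum_def using assms(2) by (subst sum.atMost_Suc_shift) simp
  also have "\<dots> \<le> (\<Sum>n\<le>N. 2 * (norm (g $ n) * 2 ^ n))"
    by (intro sum_mono) (use assms(1) in \<open>simp add: mult.commute\<close>)
  also have "\<dots> = 2 * psum N g" by (simp add: psum_def sum_distrib_left)
  finally show ?thesis .
qed

lemma psum_integral: "psum (Suc N) (fps_integral0 f) \<le> 2 * psum N f"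
proof (rule psum_Suc_le)
  fix n
  have "norm (inverse (of_nat (Suc n)) :: complex) \<le> 1"
    unfolding norm_inverse norm_of_nat by (simp add: field_simps)
  then show "norm (fps_integral0 f $ Suc n) \<le> norm (f $ n)"
    unfolding fps_integral_nth_0_Suc norm_mult by (intro mult_left_le_one_le) auto
qed simp

text \<open>The factor \<open>j \<le> n\<close> produced by the derivative is absorbed by the factor \<open>1 / (n + 1)\<close> of the
  integral, so that no derivative is lost.\<close>

lemma psum_integral_mult_XD:
  "psum (Suc N) (fps_integral0 (f * fps_XD g)) \<le> 2 * (psum N f * psum N g)"
proof -
  \<comment> \<open>With the series of absolute values the convolution of norms is a coefficient of
    \<open>F * G\<close>, so that \<open>psum_mult\<close> applies.\<close>
  define F where "F = Abs_fps (\<lambda>n. of_real (norm (f $ n)) :: complex)"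
  define G where "G = Abs_fps (\<lambda>n. of_real (norm (g $ n)) :: complex)"
  have FG: "psum N F = psum N f" "psum N G = psum N g" for N
    by (auto simp: F_def G_def psum_def)
  have "norm (fps_integral0 (f * fps_XD g) $ Suc n) \<le> norm ((F * G) $ n)" for n
  proof -
    have "norm ((f * fps_XD g) $ n) \<le> (\<Sum>i\<le>n. norm (f $ i * fps_XD g $ (n - i)))"
      unfolding fps_mult_nth atLeast0AtMost by (rule norm_sum)
    also have "\<dots> \<le> (\<Sum>i\<le>n. real (Suc n) * (norm (f $ i) * norm (g $ (n - i))))"
    proof (rule sum_mono)
      fix i
      have "fps_XD g $ (n - i) = of_nat (n - i) * g $ (n - i)"
        by (rule fps_XD_nth)
      then have "norm (fps_XD g $ (n - i)) = real (n - i) * norm (g $ (n - i))"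
        by (simp add: norm_mult)
      also have "\<dots> \<le> real (Suc n) * norm (g $ (n - i))"
        by (intro mult_right_mono) auto
      finally show "norm (f $ i * fps_XD g $ (n - i)) \<le> real (Suc n) * (norm (f $ i) * norm (g $ (n - i)))"
        unfolding norm_mult by (metis mult.left_commute mult_left_mono norm_ge_zero)
    qed
    also have "\<dots> = real (Suc n) * (\<Sum>i\<le>n. norm (f $ i) * norm (g $ (n - i)))"
      by (simp add: sum_distrib_left)
    also have "(\<Sum>i\<le>n. norm (f $ i) * norm (g $ (n - i))) = norm ((F * G) $ n)"
    proof -
      have "(F * G) $ n = of_real (\<Sum>i\<le>n. norm (f $ i) * norm (g $ (n - i)))"
        by (simp add: fps_mult_nth F_def G_def atLeast0AtMost)
      then show ?thesis by (simp add: sum_nonneg del: of_real_sum)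
    qed
    finally have *: "norm ((f * fps_XD g) $ n) \<le> real (Suc n) * norm ((F * G) $ n)" .
    have "norm (fps_integral0 (f * fps_XD g) $ Suc n) = norm ((f * fps_XD g) $ n) / real (Suc n)"
      unfolding fps_integral_nth_0_Suc norm_mult norm_inverse norm_of_nat by (simp add: field_simps)
    also have "\<dots> \<le> norm ((F * G) $ n)"
      using * by (simp add: field_simps)
    finally show ?thesis .
  qed
  then have "psum (Suc N) (fps_integral0 (f * fps_XD g)) \<le> 2 * psum N (F * G)"
    by (intro psum_Suc_le) auto
  also have "\<dots> \<le> 2 * (psum N f * psum N g)"
    using psum_mult[of N F G] by (simp add: FG)
  finally show ?thesis .
qed

section \<open>Weighted homogeneity of formal power series\<close>

text \<open>This is the functional relation \<open>f(X) = t^d g(t X)\<close>. The exponent is an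
  integer because the variable itself has weight -1.\<close>

definition weighted :: "complex \<Rightarrow> int \<Rightarrow> complex fps \<Rightarrow> complex fps \<Rightarrow> bool" where
  "weighted t d f g \<longleftrightarrow> (\<forall>n. f $ n = t powi (d + int n) * g $ n)"

lemma weighted_add: "weighted t d f f' \<Longrightarrow> weighted t d g g' \<Longrightarrow> weighted t d (f + g) (f' + g')"
  by (simp add: weighted_def distrib_left)

lemma weighted_mult:
  assumes "t \<noteq> 0" "weighted t c f f'" "weighted t d g g'" "b = c + d"
  shows "weighted t b (f * g) (f' * g')"
  unfolding weighted_def
proof
  fix n
  have "f $ i * g $ (n - i) = t powi (b + int n) * (f' $ i * g' $ (n - i))" if "i \<le> n" for i
  proof -
    have "t powi (b + int n) = t powi (c + int i) * t powi (d + int (n - i))"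
      using that assms(1,4) by (subst power_int_add[symmetric]) (auto simp: algebra_simps of_nat_diff)
    then show ?thesis using assms(2,3) by (simp add: weighted_def)
  qed
  then show "(f * g) $ n = t powi (b + int n) * (f' * g') $ n"
    by (simp add: fps_mult_nth sum_distrib_left)
qed

lemma weighted_const: "c = t powi d * c' \<Longrightarrow> weighted t d (fps_const c) (fps_const c')"
  by (simp add: weighted_def)

lemma weighted_X: "weighted t (-1) fps_X fps_X"
  by (simp add: weighted_def fps_X_def)

lemma weighted_XD: "weighted t d f f' \<Longrightarrow> weighted t d (fps_XD f) (fps_XD f')"
  by (simp add: weighted_def fps_XD_nth)

text \<open>Integration moves coefficient \<open>n\<close> to place \<open>n + 1\<close>, so the
  weight drops by one; the constant sits at place 0 and scales by \<open>t powi d\<close>.\<close>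

lemma weighted_integral:
  assumes "weighted t (d + 1) f f'" "c = t powi d * c'"
  shows "weighted t d (fps_integral f c) (fps_integral f' c')"
  using assms by (auto simp: weighted_def fps_integral_def algebra_simps of_nat_diff split: nat.split)

section \<open>The Picard iteration and its fixed point\<close>

context
  fixes k a :: complex
begin

text \<open>
  After the substitution the common denominator of the field is \<open>g = 1 - t H\<close> and the equations read
  \<open>g Z' = \<epsilon>\<close>, \<open>g P' = G\<close> with \<open>k = 2\<kappa>\<^sub>0\<close> and \<open>a = 4\<kappa>\<^sub>0 - 2\<theta>\<^sub>\<infinity>\<close>. They are solved in the form
  \<open>Z' = \<epsilon> + H (t Z')\<close>, \<open>P' = G + H (t P')\<close>, where \<open>fps_XD\<close> is \<open>t d/dt\<close>.
\<close>

definition coeff_H :: "complex \<Rightarrow> complex fps \<Rightarrow> complex fps \<Rightarrow> complex fps" where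
  "coeff_H e Z P = fps_const 2 * Z + fps_const (a * e) * fps_X + fps_const 2 * (fps_X * (fps_X * P))"

definition coeff_G :: "complex \<Rightarrow> complex fps \<Rightarrow> complex fps \<Rightarrow> complex fps" where
  "coeff_G e Z P = fps_const 2 * (P * Z) + fps_const (k * (a - k) * e\<^sup>2)
     + fps_const (2 * a * e) * (fps_X * P) + fps_const 3 * ((fps_X * P) * (fps_X * P))"

definition step_Z where
  "step_Z r e Z P = fps_integral (fps_const e + coeff_H e Z P * fps_XD Z) r"

definition step_P where
  "step_P c e Z P = fps_integral (coeff_G e Z P + coeff_H e Z P * fps_XD P) c"

text \<open>Picard iteration from the zero series; \<open>c\<close> and \<open>r\<close> are the
  initial values of \<open>P\<close> and \<open>Z\<close>.\<close>

primrec iter :: "complex \<Rightarrow> complex \<Rightarrow> complex \<Rightarrow> nat \<Rightarrow> complex fps \<times> complex fps" where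
  "iter c r e 0 = (0, 0)"
| "iter c r e (Suc n) = (step_Z r e (fst (iter c r e n)) (snd (iter c r e n)),
                         step_P c e (fst (iter c r e n)) (snd (iter c r e n)))"

text \<open>The limit of the iterates: coefficient \<open>n\<close> no longer changes from iterate
  \<open>n + 1\<close> on, so it is read off there.\<close>

definition "sol_Z c r e = Abs_fps (\<lambda>n. fst (iter c r e (Suc n)) $ n)"
definition "sol_P c r e = Abs_fps (\<lambda>n. snd (iter c r e (Suc n)) $ n)"

lemma agree_H: "agree n Z Z' \<Longrightarrow> agree n P P' \<Longrightarrow> agree n (coeff_H e Z P) (coeff_H e Z' P')"
  unfolding coeff_H_def by (intro agree_add agree_mult agree_refl)

lemma agree_G: "agree n Z Z' \<Longrightarrow> agree n P P' \<Longrightarrow> agree n (coeff_G e Z P) (coeff_G e Z' P')"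
  unfolding coeff_G_def by (intro agree_add agree_mult agree_refl)

lemma agree_step:
  assumes "agree n Z Z'" "agree n P P'"
  shows "agree (Suc n) (step_Z r e Z P) (step_Z r e Z' P')"
    and "agree (Suc n) (step_P c e Z P) (step_P c e Z' P')"
  unfolding step_Z_def step_P_def
  by (intro agree_integral agree_add agree_mult agree_XD agree_H agree_G agree_refl assms)+

lemma agree_iter:
  "agree n (fst (iter c r e n)) (fst (iter c r e (n + m))) \<and>
   agree n (snd (iter c r e n)) (snd (iter c r e (n + m)))"
  by (induction n) (auto intro: agree_step simp: agree_def[of 0])

lemma agree_sol:
  "agree n (sol_Z c r e) (fst (iter c r e n))" "agree n (sol_P c r e) (snd (iter c r e n))"
proof -
  have "fst (iter c r e (Suc m)) $ m = fst (iter c r e n) $ m \<and>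
        snd (iter c r e (Suc m)) $ m = snd (iter c r e n) $ m" if "m < n" for m
    using agree_iter[of "Suc m" c r e "n - Suc m"] that unfolding agree_def by simp
  then show "agree n (sol_Z c r e) (fst (iter c r e n))" "agree n (sol_P c r e) (snd (iter c r e n))"
    unfolding agree_def sol_Z_def sol_P_def by simp_all
qed

text \<open>The limit agrees with iterate \<open>n\<close> below order \<open>n\<close>; one step
  improves this to order \<open>n + 1\<close>, which covers coefficient \<open>n\<close> of iterate
  \<open>n + 1\<close>, the one that defines the limit.\<close>

lemma sol_fixpoint:
  "sol_Z c r e = step_Z r e (sol_Z c r e) (sol_P c r e)"
  "sol_P c r e = step_P c e (sol_Z c r e) (sol_P c r e)"
proof -
  have "sol_Z c r e $ n = step_Z r e (sol_Z c r e) (sol_P c r e) $ n \<and>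
        sol_P c r e $ n = step_P c e (sol_Z c r e) (sol_P c r e) $ n" for n
    using agree_step(1)[OF agree_sol[of n c r e], of r e] agree_step(2)[OF agree_sol[of n c r e], of c e]
    unfolding agree_def by (auto simp: sol_Z_def sol_P_def)
  then show "sol_Z c r e = step_Z r e (sol_Z c r e) (sol_P c r e)"
    "sol_P c r e = step_P c e (sol_Z c r e) (sol_P c r e)"
    by (auto simp: fps_eq_iff)
qed

lemma sol_0: "sol_Z c r e $ 0 = r" "sol_P c r e $ 0 = c"
  by (simp_all add: sol_Z_def sol_P_def step_Z_def step_P_def)

lemma sol_deriv:
  "fps_deriv (sol_Z c r e) = fps_const e + coeff_H e (sol_Z c r e) (sol_P c r e) * fps_XD (sol_Z c r e)"
  "fps_deriv (sol_P c r e) = coeff_G e (sol_Z c r e) (sol_P c r e)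
     + coeff_H e (sol_Z c r e) (sol_P c r e) * fps_XD (sol_P c r e)"
  using arg_cong[OF sol_fixpoint(1)[of c r e], of fps_deriv] arg_cong[OF sol_fixpoint(2)[of c r e], of fps_deriv]
  unfolding step_Z_def step_P_def fps_deriv_fps_integral .

section \<open>Homogeneity of the solution under the weighted dilation\<close>

text \<open>With weights 1 for \<open>Z\<close>, 3 for \<open>P\<close>, 2 for \<open>e\<close> and
  -1 for the variable, every summand of \<open>coeff_H\<close> has weight 1, and every summand of
  \<open>coeff_G\<close> below has weight 4. The integrands of the two steps then have weights 2 and
  4, one more than \<open>Z\<close> and \<open>P\<close>.\<close>

lemma weighted_H:
  assumes "t \<noteq> 0" "weighted t 1 Z Z'" "weighted t 3 P P'"
  shows "weighted t 1 (coeff_H (t\<^sup>2 * e) Z P) (coeff_H e Z' P')"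
  unfolding coeff_H_def
  apply (intro weighted_add)
    apply (rule weighted_mult[OF assms(1) weighted_const[of _ _ 0] assms(2)]; simp)
   apply (rule weighted_mult[OF assms(1) weighted_const[of _ _ 2] weighted_X]; simp)
  apply (rule weighted_mult[OF assms(1) weighted_const[of _ _ 0]
        weighted_mult[OF assms(1) weighted_X weighted_mult[OF assms(1) weighted_X assms(3) refl] refl]]; simp)
  done

lemma weighted_G:
  assumes "t \<noteq> 0" "weighted t 1 Z Z'" "weighted t 3 P P'"
  shows "weighted t 4 (coeff_G (t\<^sup>2 * e) Z P) (coeff_G e Z' P')"
proof -
  have XP: "weighted t 2 (fps_X * P) (fps_X * P')"
    by (rule weighted_mult[OF assms(1) weighted_X assms(3)]) simp
  show ?thesis
    unfolding coeff_G_def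
    apply (intro weighted_add)
       apply (rule weighted_mult[OF assms(1) weighted_const[of _ _ 0] weighted_mult[OF assms(1,3,2) refl]]; simp)
      apply (rule weighted_const, simp add: power_mult_distrib)
     apply (rule weighted_mult[OF assms(1) weighted_const[of _ _ 2] XP]; simp)
    apply (rule weighted_mult[OF assms(1) weighted_const[of _ _ 0] weighted_mult[OF assms(1) XP XP refl]]; simp)
    done
qed

lemma weighted_iter:
  assumes "t \<noteq> 0"
  shows "weighted t 1 (fst (iter (t ^ 3 * c) (t * r) (t\<^sup>2 * e) n)) (fst (iter c r e n)) \<and>
         weighted t 3 (snd (iter (t ^ 3 * c) (t * r) (t\<^sup>2 * e) n)) (snd (iter c r e n))"
proof (induction n)
  case 0
  then show ?case by (simp add: weighted_def)
next
  case (Suc n)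
  note Z = conjunct1[OF Suc] and P = conjunct2[OF Suc]
  note H = weighted_H[OF assms Z P]
  have "weighted t 1 (step_Z (t * r) (t\<^sup>2 * e) (fst (iter (t ^ 3 * c) (t * r) (t\<^sup>2 * e) n))
        (snd (iter (t ^ 3 * c) (t * r) (t\<^sup>2 * e) n)))
      (step_Z r e (fst (iter c r e n)) (snd (iter c r e n)))"
    unfolding step_Z_def
    by (rule weighted_integral, intro weighted_add weighted_const weighted_mult[OF assms H weighted_XD[OF Z]]) 
      simp_all
  moreover have "weighted t 3 (step_P (t ^ 3 * c) (t\<^sup>2 * e) (fst (iter (t ^ 3 * c) (t * r) (t\<^sup>2 * e) n))
        (snd (iter (t ^ 3 * c) (t * r) (t\<^sup>2 * e) n)))
      (step_P c e (fst (iter c r e n)) (snd (iter c r e n)))"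
    unfolding step_P_def
    by (rule weighted_integral, rule weighted_add)
      (use weighted_G[OF assms Z P] weighted_mult[OF assms H weighted_XD[OF P]] in simp_all)
  ultimately show ?case
    by (simp only: iter.simps fst_conv snd_conv)
qed

text \<open>Homogeneity passes from the iterates to the limit coefficient by coefficient. Up to the
  factors \<open>t\<close> and \<open>t ^ 3\<close>, dilating the data amounts to running the
  original solution until time \<open>t\<close> instead of 1.\<close>

lemma weighted_sol:
  assumes "t \<noteq> 0"
  shows "weighted t 1 (sol_Z (t ^ 3 * c) (t * r) (t\<^sup>2 * e)) (sol_Z c r e)"
    and "weighted t 3 (sol_P (t ^ 3 * c) (t * r) (t\<^sup>2 * e)) (sol_P c r e)"
  using weighted_iter[OF assms, of c r e] by (simp_all add: weighted_def sol_Z_def sol_P_def del: iter.simps)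

end

section \<open>Convergence\<close>

text \<open>Partial sums bounded uniformly in \<open>N\<close> give absolute convergence at radius
  2. The geometric decay of the coefficients later supplies the majorant for Weierstrass'
  theorem.\<close>

lemma psum_bounded:
  assumes "\<And>N. psum N f \<le> b"
  shows "fps_conv_radius f \<ge> 2" "norm (eval_fps f 1) \<le> b" "norm (f $ n) \<le> b * (1 / 2) ^ n"
proof -
  have 1: "norm (f $ n) * 2 ^ n \<le> b" for n
  proof -
    have "norm (f $ n) * 2 ^ n \<le> psum n f"
      unfolding psum_def by (rule member_le_sum) auto
    then show ?thesis using assms[of n] by linarith
  qed
  then show "norm (f $ n) \<le> b * (1 / 2) ^ n"
    by (simp add: field_simps)
  have sm: "summable (\<lambda>n. norm (f $ n) * 2 ^ n)"
  proof (rule bounded_imp_summable[where B = b])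
    show "(\<Sum>k\<le>n. norm (f $ k) * 2 ^ k) \<le> b" for n
      using assms[of n] by (simp add: psum_def)
  qed simp
  have "summable (\<lambda>n. norm (f $ n * 2 ^ n))"
    using sm by (simp add: norm_mult norm_power)
  then have "summable (\<lambda>n. f $ n * 2 ^ n)" by (rule summable_norm_cancel)
  from conv_radius_geI[OF this] show cr: "fps_conv_radius f \<ge> 2"
    by (simp add: fps_conv_radius_def)
  have s1: "summable (\<lambda>n. norm (f $ n))"
    by (rule summable_comparison_test'[OF sm, of 0]) (simp add: mult_le_cancel_left1)
  have "norm (eval_fps f 1) \<le> (\<Sum>n. norm (f $ n))"
    unfolding eval_fps_def using summable_norm[OF s1] by simp
  also have "\<dots> \<le> (\<Sum>n. norm (f $ n) * 2 ^ n)"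
    by (rule suminf_le[OF _ s1 sm]) (simp add: mult_le_cancel_left1)
  also have "\<dots> \<le> b"
  proof (rule suminf_le_const[OF sm])
    show "(\<Sum>k<n. norm (f $ k) * 2 ^ k) \<le> b" for n
    proof -
      have "(\<Sum>k<n. norm (f $ k) * 2 ^ k) \<le> psum n f"
        unfolding psum_def by (rule sum_mono2) auto
      then show ?thesis using assms[of n] by linarith
    qed
  qed
  finally show "norm (eval_fps f 1) \<le> b" .
qed

section \<open>Evaluation at 1\<close>

text \<open>Bundling convergence beyond 1 with the value lets evaluation pass structurally through
  sums and products.\<close>

definition eval1 :: "complex fps \<Rightarrow> complex \<Rightarrow> bool" where
  "eval1 f v \<longleftrightarrow> 1 < fps_conv_radius f \<and> eval_fps f 1 = v"

lemma eval1_add: "eval1 f u \<Longrightarrow> eval1 g v \<Longrightarrow> eval1 (f + g) (u + v)"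
  using fps_conv_radius_add[of f g] by (auto simp: eval1_def eval_fps_add one_ereal_def min_def split: if_splits)

lemma eval1_mult: "eval1 f u \<Longrightarrow> eval1 g v \<Longrightarrow> eval1 (f * g) (u * v)"
  using fps_conv_radius_mult[of f g] by (auto simp: eval1_def eval_fps_mult one_ereal_def min_def split: if_splits)

lemma eval1_const: "eval1 (fps_const c) c"
  by (simp add: eval1_def)

lemma eval1_X: "eval1 fps_X 1"
  by (simp add: eval1_def)

lemma eval1_deriv: "1 < fps_conv_radius f \<Longrightarrow> eval1 (fps_deriv f) (eval_fps (fps_deriv f) 1)"
  using fps_conv_radius_deriv[of f] by (auto simp: eval1_def)

section \<open>A priori bounds and the differential equation at time 1\<close>

context
  fixes k a :: complex
begin

text \<open>The weighted norm of the linear part: \<open>r + e X\<close> for \<open>Z\<close> and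
  \<open>c\<close> for \<open>P\<close>, whence the factor 2.\<close>

definition size0 :: "complex \<Rightarrow> complex \<Rightarrow> complex \<Rightarrow> real" where
  "size0 c r e = norm c + norm r + 2 * norm e"

text \<open>In units of \<open>d\<^sup>2\<close>, \<open>psum_sol_Suc\<close> collects twice
  \<open>48 + norm (k * (a - k)) + 8 * norm a\<close> from \<open>G\<close> and
  \<open>64 + 8 * norm a\<close> from the terms with \<open>H\<close>; 176 exceeds the resulting
  160.\<close>

definition Kbound :: real where
  "Kbound = 176 + 24 * norm a + 2 * norm (k * (a - k))"

text \<open>Beyond the linear part, every term of the fixed point equation is a product of at least
  two small quantities. A linear bound in degree \<open>N\<close> therefore gives a quadratic one
  for the remainder in degree \<open>Suc N\<close>.\<close>

lemma psum_sol_Suc: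
  fixes c r e :: complex
  defines "Z \<equiv> sol_Z k a c r e" and "P \<equiv> sol_P k a c r e" and "d \<equiv> size0 c r e"
  assumes S: "psum N Z + psum N P \<le> 2 * d"
  shows "psum (Suc N) (Z - fps_const r - fps_const e * fps_X)
          + psum (Suc N) (P - fps_const c) \<le> Kbound * d\<^sup>2"
proof -
  define H where "H = coeff_H a e Z P"
  define G where "G = coeff_G k a e Z P"
  have d: "0 \<le> d" "norm e \<le> d" by (auto simp: d_def size0_def)
  have pZ: "0 \<le> psum N Z" "0 \<le> psum N P" by (auto simp: psum_nonneg)
  have XP: "psum N (fps_X * P) \<le> 2 * psum N P" by (rule psum_X_mult)
  have eX: "psum N (fps_const b * fps_X) \<le> norm b * 2" for b
    unfolding psum_const_mult by (intro mult_left_mono psum_X) auto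
  have "psum N H \<le> 2 * psum N Z + norm (a * e) * 2 + 2 * (2 * (2 * psum N P))"
  proof -
    have "psum N (fps_const 2 * (fps_X * (fps_X * P))) \<le> 2 * (2 * (2 * psum N P))"
      unfolding psum_const_mult using psum_X_mult[of N "fps_X * P"] XP by simp
    moreover have "psum N (fps_const 2 * Z) = 2 * psum N Z" by (simp add: psum_const_mult)
    ultimately show ?thesis
      unfolding H_def coeff_H_def using eX[of "a * e"]
      by (intro order_trans[OF psum_add] add_mono) auto
  qed
  also have "\<dots> \<le> 16 * d + 2 * norm a * d"
  proof -
    have "norm (a * e) \<le> norm a * d"
      unfolding norm_mult by (intro mult_left_mono d) auto
    then show ?thesis using S pZ by linarith
  qed
  finally have H: "psum N H \<le> 16 * d + 2 * norm a * d" .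
  have G: "psum N G \<le> 2 * (psum N P * psum N Z) + norm (k * (a - k) * e\<^sup>2)
      + norm (2 * a * e) * (2 * psum N P) + 3 * ((2 * psum N P) * (2 * psum N P))"
  proof -
    have "psum N (fps_const 2 * (P * Z)) \<le> 2 * (psum N P * psum N Z)"
      unfolding psum_const_mult using psum_mult[of N P Z] by simp
    moreover have "psum N (fps_const (2 * a * e) * (fps_X * P)) \<le> norm (2 * a * e) * (2 * psum N P)"
      unfolding psum_const_mult by (intro mult_left_mono XP) auto
    moreover have "psum N (fps_const 3 * ((fps_X * P) * (fps_X * P))) \<le> 3 * ((2 * psum N P) * (2 * psum N P))"
    proof -
      have "psum N (fps_X * P) * psum N (fps_X * P) \<le> (2 * psum N P) * (2 * psum N P)"
        by (intro mult_mono XP psum_nonneg) (simp add: pZ)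
      then show ?thesis
        unfolding psum_const_mult using psum_mult[of N "fps_X * P" "fps_X * P"] by simp
    qed
    ultimately show ?thesis
      unfolding G_def coeff_G_def
      by (intro order_trans[OF psum_add] add_mono) (auto simp: psum_const)
  qed
  \<comment> \<open>This is half of the contribution \<open>2 P Z + 12 P^2\<close> to the bound on
    \<open>G\<close>.\<close>
  have bds: "psum N P * psum N Z + 6 * (psum N P * psum N P) \<le> 24 * d\<^sup>2"
  proof -
    have "psum N P * psum N Z + 6 * (psum N P * psum N P) \<le> 6 * (psum N P * (psum N Z + psum N P))"
      using pZ by (simp add: algebra_simps)
    also have "\<dots> \<le> 6 * (2 * d * (2 * d))"
      using pZ S d by (intro mult_left_mono mult_mono) auto
    finally show ?thesis by (simp add: power2_eq_square)
  qed
  have ke2: "norm (k * (a - k) * e\<^sup>2) \<le> norm (k * (a - k)) * d\<^sup>2"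
    unfolding norm_mult[of "k * (a - k)"] norm_power using d by (intro mult_left_mono power_mono) auto
  have aeP: "norm (2 * a * e) * (2 * psum N P) \<le> 8 * norm a * d\<^sup>2"
  proof -
    have "norm (2 * a * e) * (2 * psum N P) \<le> (2 * norm a * d) * (2 * (2 * d))"
      using pZ S d by (intro mult_mono) (auto simp: norm_mult intro!: mult_left_mono)
    then show ?thesis by (simp add: power2_eq_square algebra_simps)
  qed
  have G': "psum N G \<le> 48 * d\<^sup>2 + norm (k * (a - k)) * d\<^sup>2 + 8 * norm a * d\<^sup>2"
    using G bds ke2 aeP by (simp add: algebra_simps)
  have Z: "Z - fps_const r - fps_const e * fps_X = fps_integral0 (H * fps_XD Z)"
  proof -
    have "Z = fps_integral (fps_const e + H * fps_XD Z) r"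
      using sol_fixpoint(1)[of k a c r e] by (simp add: Z_def P_def H_def step_Z_def)
    also have "\<dots> = fps_const e * fps_X + fps_integral0 (H * fps_XD Z) + fps_const r"
      by (subst fps_integral_conv_plus_const) (simp add: fps_integral0_add fps_integral0_fps_const)
    finally show ?thesis by (simp add: algebra_simps)
  qed
  have P: "P - fps_const c = fps_integral0 G + fps_integral0 (H * fps_XD P)"
  proof -
    have "P = fps_integral (G + H * fps_XD P) c"
      using sol_fixpoint(2)[of k a c r e] by (simp add: Z_def P_def H_def G_def step_P_def)
    also have "\<dots> = fps_integral0 G + fps_integral0 (H * fps_XD P) + fps_const c"
      by (subst fps_integral_conv_plus_const) (simp add: fps_integral0_add)
    finally show ?thesis by (simp add: algebra_simps)
  qed
  have "psum (Suc N) (Z - fps_const r - fps_const e * fps_X) + psum (Suc N) (P - fps_const c)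
      \<le> 2 * (psum N H * psum N Z) + (2 * psum N G + 2 * (psum N H * psum N P))"
    unfolding Z P
    by (intro add_mono order_trans[OF psum_add] psum_integral psum_integral_mult_XD)
  also have "\<dots> = 2 * psum N G + 2 * (psum N H * (psum N Z + psum N P))"
    by (simp add: algebra_simps)
  also have "\<dots> \<le> 2 * psum N G + 2 * ((16 * d + 2 * norm a * d) * (2 * d))"
    using S H pZ d by (intro add_mono mult_left_mono mult_mono) auto
  also have "\<dots> \<le> Kbound * d\<^sup>2"
  proof -
    have "Kbound * d\<^sup>2 = 112 * d\<^sup>2 + 16 * norm a * d\<^sup>2 + 2 * (norm (k * (a - k)) * d\<^sup>2)
       + 64 * d\<^sup>2 + 8 * norm a * d\<^sup>2"
      by (simp add: Kbound_def algebra_simps)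
    moreover have "2 * ((16 * d + 2 * norm a * d) * (2 * d)) = 64 * d\<^sup>2 + 8 * norm a * d\<^sup>2"
      by (simp add: power2_eq_square algebra_simps)
    ultimately show ?thesis using G' zero_le_power2[of d] by linarith
  qed
  finally show ?thesis .
qed

text \<open>Bootstrapping in \<open>N\<close>: the linear part contributes at most \<open>d\<close>
  and the remainder at most \<open>Kbound * d\<^sup>2 \<le> d\<close>, so the bound
  \<open>2 * d\<close> reproduces itself.\<close>

lemma psum_sol:
  assumes small: "Kbound * size0 c r e \<le> 1"
  shows "psum N (sol_Z k a c r e) + psum N (sol_P k a c r e) \<le> 2 * size0 c r e"
proof (induction N)
  case 0
  then show ?case by (simp add: psum_def sol_0 size0_def)
next
  case (Suc N)
  define Z P d where "Z = sol_Z k a c r e" and "P = sol_P k a c r e" and "d = size0 c r e"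
  have d: "0 \<le> d" by (simp add: d_def size0_def)
  have "Kbound * d\<^sup>2 \<le> d"
    using mult_right_mono[OF small, of d] d by (simp add: d_def power2_eq_square mult.assoc)
  moreover have "psum (Suc N) Z \<le> psum (Suc N) (Z - fps_const r - fps_const e * fps_X) + (norm r + norm e * 2)"
  proof -
    have "Z = (Z - fps_const r - fps_const e * fps_X) + (fps_const r + fps_const e * fps_X)" by simp
    then have "psum (Suc N) Z \<le> psum (Suc N) (Z - fps_const r - fps_const e * fps_X)
        + (psum (Suc N) (fps_const r) + psum (Suc N) (fps_const e * fps_X))"
      by (metis psum_add add_left_mono order_trans)
    moreover have "psum (Suc N) (fps_const e * fps_X) \<le> norm e * 2"
      unfolding psum_const_mult by (intro mult_left_mono psum_X) auto
    ultimately show ?thesis by (simp add: psum_const)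
  qed
  moreover have "psum (Suc N) P \<le> psum (Suc N) (P - fps_const c) + norm c"
    using psum_add[of "Suc N" "P - fps_const c" "fps_const c"] by (simp add: psum_const)
  moreover have "psum (Suc N) (Z - fps_const r - fps_const e * fps_X) + psum (Suc N) (P - fps_const c)
      \<le> Kbound * d\<^sup>2"
    unfolding Z_def P_def d_def by (rule psum_sol_Suc[OF Suc])
  ultimately show ?case
    unfolding Z_def[symmetric] P_def[symmetric] d_def[symmetric] by (simp add: d_def size0_def)
qed

lemma psum_sol_each:
  assumes small: "Kbound * size0 c r e \<le> 1"
  shows "psum N (sol_Z k a c r e) \<le> 2 * size0 c r e" "psum N (sol_P k a c r e) \<le> 2 * size0 c r e"
  using psum_sol[OF small, of N] psum_nonneg[of N "sol_Z k a c r e"] psum_nonneg[of N "sol_P k a c r e"]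
  by linarith+

lemma sol_radius:
  assumes "Kbound * size0 c r e \<le> 1"
  shows "1 < fps_conv_radius (sol_Z k a c r e)" "1 < fps_conv_radius (sol_P k a c r e)"
  by (rule less_le_trans[OF _ psum_bounded(1)[OF psum_sol_each(1)[OF assms]]]
        less_le_trans[OF _ psum_bounded(1)[OF psum_sol_each(2)[OF assms]]], simp)+

text \<open>The remainder bound holds for all truncations, hence for the values at 1, where
  \<open>r + e X\<close> becomes \<open>r + e\<close>. This will make the linearising map tangent to
  the identity.\<close>

lemma sol_linear_part:
  assumes "Kbound * size0 c r e \<le> 1"
  shows "norm (eval_fps (sol_Z k a c r e) 1 - (r + e)) \<le> Kbound * (size0 c r e)\<^sup>2"
    and "norm (eval_fps (sol_P k a c r e) 1 - c) \<le> Kbound * (size0 c r e)\<^sup>2"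
proof -
  define Z P d where "Z = sol_Z k a c r e" and "P = sol_P k a c r e" and "d = size0 c r e"
  \<comment> \<open>\<open>psum_sol_Suc\<close> speaks of degrees \<open>Suc N\<close> while
    \<open>psum_bounded\<close> asks for all degrees; monotonicity in \<open>N\<close> closes the
    gap.\<close>
  have le: "psum N f \<le> b" if "psum (Suc N) f \<le> b" for N f b
    using that unfolding psum_def by (rule order_trans[rotated]) (auto intro!: sum_mono2)
  have "psum (Suc N) (Z - fps_const r - fps_const e * fps_X) + psum (Suc N) (P - fps_const c)
      \<le> Kbound * d\<^sup>2" for N
    unfolding Z_def P_def d_def by (rule psum_sol_Suc[OF psum_sol[OF assms]])
  then have "psum (Suc N) (Z - fps_const r - fps_const e * fps_X) \<le> Kbound * d\<^sup>2"
    "psum (Suc N) (P - fps_const c) \<le> Kbound * d\<^sup>2" for N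
    using psum_nonneg[of "Suc N" "Z - fps_const r - fps_const e * fps_X"]
      psum_nonneg[of "Suc N" "P - fps_const c"] by (smt (verit))+
  from this[THEN le, THEN psum_bounded(2)]
  have "norm (eval_fps (Z - fps_const r - fps_const e * fps_X) 1) \<le> Kbound * d\<^sup>2"
    "norm (eval_fps (P - fps_const c) 1) \<le> Kbound * d\<^sup>2" by auto
  moreover have "Z - fps_const r - fps_const e * fps_X = Z + (fps_const (- r) + fps_const (- e) * fps_X)"
    "P - fps_const c = P + fps_const (- c)"
    by (simp_all flip: fps_const_neg)
  moreover have "eval_fps (Z + (fps_const (- r) + fps_const (- e) * fps_X)) 1 = eval_fps Z 1 - (r + e)"
  proof -
    have "eval1 (Z + (fps_const (- r) + fps_const (- e) * fps_X)) (eval_fps Z 1 + (- r + - e * 1))"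
      using sol_radius[OF assms]
      by (intro eval1_add eval1_const eval1_mult eval1_X) (simp add: eval1_def Z_def)
    then show ?thesis by (simp add: eval1_def algebra_simps)
  qed
  moreover have "eval_fps (P + fps_const (- c)) 1 = eval_fps P 1 - c"
    using eval1_add[OF _ eval1_const, of P "eval_fps P 1" "- c"] sol_radius[OF assms]
    by (simp add: eval1_def P_def)
  ultimately have "norm (eval_fps Z 1 - (r + e)) \<le> Kbound * d\<^sup>2" "norm (eval_fps P 1 - c) \<le> Kbound * d\<^sup>2"
    by metis+
  then show "norm (eval_fps (sol_Z k a c r e) 1 - (r + e)) \<le> Kbound * (size0 c r e)\<^sup>2"
    "norm (eval_fps (sol_P k a c r e) 1 - c) \<le> Kbound * (size0 c r e)\<^sup>2"
    by (simp_all only: Z_def P_def d_def)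
qed

text \<open>At 1 the series \<open>fps_XD f\<close> and \<open>fps_deriv f\<close> have the same
  value, so evaluating \<open>sol_deriv\<close> puts \<open>z'\<close> and \<open>p'\<close> on both
  sides; collecting them restores the denominator.\<close>

lemma sol_ode:
  fixes c r e :: complex
  assumes "Kbound * size0 c r e \<le> 1"
  defines "z \<equiv> eval_fps (sol_Z k a c r e) 1" and "p \<equiv> eval_fps (sol_P k a c r e) 1"
    and "z' \<equiv> eval_fps (fps_deriv (sol_Z k a c r e)) 1" and "p' \<equiv> eval_fps (fps_deriv (sol_P k a c r e)) 1"
  shows "(1 - (2 * z + a * e + 2 * p)) * z' = e"
    and "(1 - (2 * z + a * e + 2 * p)) * p' = 2 * p * z + k * (a - k) * e\<^sup>2 + 2 * a * e * p + 3 * p\<^sup>2"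
proof -
  note R = sol_radius[OF assms(1)]
  have Z: "eval1 (sol_Z k a c r e) z" and P: "eval1 (sol_P k a c r e) p"
    using R by (simp_all add: eval1_def z_def p_def)
  have Z': "eval1 (fps_deriv (sol_Z k a c r e)) z'" and P': "eval1 (fps_deriv (sol_P k a c r e)) p'"
    using R by (simp_all add: eval1_deriv z'_def p'_def)
  have H: "eval1 (coeff_H a e (sol_Z k a c r e) (sol_P k a c r e)) (2 * z + a * e * 1 + 2 * (1 * (1 * p)))"
    unfolding coeff_H_def by (intro eval1_add eval1_mult eval1_const eval1_X Z P)
  have G: "eval1 (coeff_G k a e (sol_Z k a c r e) (sol_P k a c r e))
      (2 * (p * z) + k * (a - k) * e\<^sup>2 + 2 * a * e * (1 * p) + 3 * ((1 * p) * (1 * p)))"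
    unfolding coeff_G_def by (intro eval1_add eval1_mult eval1_const eval1_X Z P)
  have "z' = e + (2 * z + a * e * 1 + 2 * (1 * (1 * p))) * (1 * z')"
    using eval1_add[OF eval1_const eval1_mult[OF H eval1_mult[OF eval1_X Z']], of e] Z'
    unfolding sol_deriv(1)[of k a c r e, unfolded fps_XD_def o_def, symmetric] by (simp add: eval1_def)
  moreover have "p' = (2 * (p * z) + k * (a - k) * e\<^sup>2 + 2 * a * e * (1 * p) + 3 * ((1 * p) * (1 * p)))
      + (2 * z + a * e * 1 + 2 * (1 * (1 * p))) * (1 * p')"
    using eval1_add[OF G eval1_mult[OF H eval1_mult[OF eval1_X P']]] P'
    unfolding sol_deriv(2)[of k a c r e, unfolded fps_XD_def o_def, symmetric] by (simp add: eval1_def)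
  ultimately show "(1 - (2 * z + a * e + 2 * p)) * z' = e"
    "(1 - (2 * z + a * e + 2 * p)) * p' = 2 * p * z + k * (a - k) * e\<^sup>2 + 2 * a * e * p + 3 * p\<^sup>2"
    by (simp_all add: algebra_simps power2_eq_square)
qed

lemma eval_weighted:
  assumes "weighted t d f g"  "norm t < fps_conv_radius g" "t \<noteq> 0"
  shows "eval_fps f 1 = t powi d * eval_fps g t"
proof -
  have "eval_fps f 1 = (\<Sum>n. t powi d * (g $ n * t ^ n))"
    using assms(1,3) by (simp add: eval_fps_def weighted_def power_int_add algebra_simps)
  also have "\<dots> = t powi d * eval_fps g t"
    unfolding eval_fps_def by (rule suminf_mult) (rule summable_fps[OF assms(2)])
  finally show ?thesis .
qed

text \<open>The weighted homogeneity of the coefficients turns the radial derivative of the sums at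
  \<open>t = 1\<close> into the time derivative of the series.\<close>

lemma sol_radial_derivative:
  assumes "Kbound * size0 c r e \<le> 1"
  shows "((\<lambda>t. eval_fps (sol_Z k a (t ^ 3 * c) (t * r) (t\<^sup>2 * e)) 1) has_field_derivative
            eval_fps (sol_Z k a c r e) 1 + eval_fps (fps_deriv (sol_Z k a c r e)) 1) (at 1)" (is ?z)
    and "((\<lambda>t. eval_fps (sol_P k a (t ^ 3 * c) (t * r) (t\<^sup>2 * e)) 1) has_field_derivative
            3 * eval_fps (sol_P k a c r e) 1 + eval_fps (fps_deriv (sol_P k a c r e)) 1) (at 1)" (is ?p)
proof -
  define Z P where "Z = sol_Z k a c r e" and "P = sol_P k a c r e"
  have R: "2 \<le> fps_conv_radius Z" "2 \<le> fps_conv_radius P"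
    unfolding Z_def P_def
    by (rule psum_bounded(1)[OF psum_sol_each(1)[OF assms]] psum_bounded(1)[OF psum_sol_each(2)[OF assms]])+
  have D: "(eval_fps f has_field_derivative eval_fps (fps_deriv f) 1) (at 1)"
    if "2 \<le> fps_conv_radius f" for f :: "complex fps"
    by (rule has_field_derivative_eval_fps, rule less_le_trans[OF _ that]) simp
  \<comment> \<open>The disc of radius 1 about 1 avoids 0, as homogeneity requires, and stays inside
    the radius of convergence.\<close>
  have inb: "norm t < 2" "t \<noteq> 0" if "t \<in> ball 1 1" for t :: complex
  proof -
    have "norm (t - 1) < 1" using that by (simp add: dist_norm norm_minus_commute)
    then show "norm t < 2" using norm_triangle_ineq[of "t - 1" 1] by simp
    show "t \<noteq> 0" using that by auto
  qed
  have lt: "ereal (norm t) < fps_conv_radius f"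
    if "t \<in> ball 1 1" "2 \<le> fps_conv_radius f" for t :: complex and f :: "complex fps"
    by (rule less_le_trans[OF _ that(2)]) (use inb(1)[OF that(1)] in simp)
  have "((\<lambda>t. t * eval_fps Z t) has_field_derivative eval_fps Z 1 + eval_fps (fps_deriv Z) 1) (at 1)"
    by (rule derivative_eq_intros D[OF R(1)] refl)+ simp
  moreover have "t * eval_fps Z t = eval_fps (sol_Z k a (t ^ 3 * c) (t * r) (t\<^sup>2 * e)) 1" if "t \<in> ball 1 1" for t
    using eval_weighted[OF weighted_sol(1)[OF inb(2)[OF that]] lt[OF that R(1)[unfolded Z_def]] inb(2)[OF that]]
    by (simp add: Z_def)
  ultimately show ?z
    unfolding Z_def[symmetric]
    by - (rule has_field_derivative_transform_within_open[of _ _ _ "ball 1 1"], assumption, auto)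
  have "((\<lambda>t. t ^ 3 * eval_fps P t) has_field_derivative 3 * eval_fps P 1 + eval_fps (fps_deriv P) 1) (at 1)"
    by (rule derivative_eq_intros D[OF R(2)] refl)+ simp
  moreover have "t ^ 3 * eval_fps P t = eval_fps (sol_P k a (t ^ 3 * c) (t * r) (t\<^sup>2 * e)) 1" if "t \<in> ball 1 1" for t
    using eval_weighted[OF weighted_sol(2)[OF inb(2)[OF that]] lt[OF that R(2)[unfolded P_def]] inb(2)[OF that]]
    by (simp add: P_def)
  ultimately show ?p
    unfolding P_def[symmetric]
    by - (rule has_field_derivative_transform_within_open[of _ _ _ "ball 1 1"], assumption, auto)
qed

end

section \<open>The linearising map\<close>

unbundle vec_syntax and no Formal_Power_Series.fps_syntax

section \<open>Holomorphic dependence of the coefficients on the data\<close>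

definition fps_diff_on :: "(complex ^ 'n::finite \<Rightarrow> complex fps) \<Rightarrow> (complex ^ 'n) set \<Rightarrow> bool" where
  "fps_diff_on F S \<longleftrightarrow> (\<forall>n. complex_diff_on (\<lambda>w. fps_nth (F w) n) S)"

lemma fps_diff_on_add: "fps_diff_on F S \<Longrightarrow> fps_diff_on G S \<Longrightarrow> fps_diff_on (\<lambda>w. F w + G w) S"
  by (simp add: fps_diff_on_def complex_diff_on_add)

lemma fps_diff_on_mult: "fps_diff_on F S \<Longrightarrow> fps_diff_on G S \<Longrightarrow> fps_diff_on (\<lambda>w. F w * G w) S"
  by (simp add: fps_diff_on_def fps_mult_nth complex_diff_on_sum complex_diff_on_mult)

lemma fps_diff_on_const: "complex_diff_on c S \<Longrightarrow> fps_diff_on (\<lambda>w. fps_const (c w)) S"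
  unfolding fps_diff_on_def
proof
  fix n assume "complex_diff_on c S"
  then show "complex_diff_on (\<lambda>w. fps_nth (fps_const (c w)) n) S"
    by (cases n) (simp_all add: complex_diff_on_const)
qed

lemma fps_diff_on_constant: "fps_diff_on (\<lambda>w. F) S"
  by (simp add: fps_diff_on_def complex_diff_on_const)

lemma fps_diff_on_XD: "fps_diff_on F S \<Longrightarrow> fps_diff_on (\<lambda>w. fps_XD (F w)) S"
  by (simp add: fps_diff_on_def complex_diff_on_cmult)

lemma fps_diff_on_integral:
  assumes "fps_diff_on F S" "complex_diff_on c S"
  shows "fps_diff_on (\<lambda>w. fps_integral (F w) (c w)) S"
  unfolding fps_diff_on_def
proof
  fix n show "complex_diff_on (\<lambda>w. fps_nth (fps_integral (F w) (c w)) n) S"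
    by (cases n) (use assms in \<open>simp_all add: fps_diff_on_def complex_diff_on_cmult del: of_nat_Suc\<close>)
qed

text \<open>A step uses only ring operations, \<open>fps_XD\<close> and integration, where each
  coefficient depends on finitely many others, so no question of convergence arises.\<close>

lemma fps_diff_on_iter:
  assumes "complex_diff_on c S" "complex_diff_on r S" "complex_diff_on e S"
  shows "fps_diff_on (\<lambda>w. fst (iter k a (c w) (r w) (e w) n)) S \<and>
         fps_diff_on (\<lambda>w. snd (iter k a (c w) (r w) (e w) n)) S"
proof (induction n)
  case 0
  then show ?case by (simp add: fps_diff_on_constant)
next
  case (Suc n)
  note Z = conjunct1[OF Suc] and P = conjunct2[OF Suc]
  have e2: "complex_diff_on (\<lambda>w. k * (a - k) * (e w)\<^sup>2) S"
    unfolding power2_eq_square by (intro complex_diff_on_mult complex_diff_on_const assms)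
  have H: "fps_diff_on (\<lambda>w. coeff_H a (e w) (fst (iter k a (c w) (r w) (e w) n))
      (snd (iter k a (c w) (r w) (e w) n))) S"
    unfolding coeff_H_def
    by (intro fps_diff_on_add fps_diff_on_mult fps_diff_on_const complex_diff_on_cmult
        complex_diff_on_const fps_diff_on_constant assms Z P)
  have G: "fps_diff_on (\<lambda>w. coeff_G k a (e w) (fst (iter k a (c w) (r w) (e w) n))
      (snd (iter k a (c w) (r w) (e w) n))) S"
    unfolding coeff_G_def
    by (intro fps_diff_on_add fps_diff_on_mult fps_diff_on_const complex_diff_on_cmult e2
        complex_diff_on_const fps_diff_on_constant assms Z P)
  show ?case
    unfolding iter.simps fst_conv snd_conv step_Z_def step_P_def
    by (intro conjI fps_diff_on_integral fps_diff_on_add fps_diff_on_mult fps_diff_on_const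
        fps_diff_on_XD H G Z P assms)
qed

lemma fps_diff_on_sol:
  assumes "complex_diff_on c S" "complex_diff_on r S" "complex_diff_on e S"
  shows "fps_diff_on (\<lambda>w. sol_Z k a (c w) (r w) (e w)) S"
    and "fps_diff_on (\<lambda>w. sol_P k a (c w) (r w) (e w)) S"
  using fps_diff_on_iter[OF assms, of k a] unfolding fps_diff_on_def sol_Z_def sol_P_def fps_nth_Abs_fps
  by blast+

section \<open>The linearising map and its derivative along the linear field\<close>

context
  fixes k a :: complex
begin

text \<open>The point \<open>w\<close> stands for \<open>(u, v, \<epsilon>)\<close>. The shifts pass
  to eigencoordinates of the linear field, which are the initial values of the series.\<close>

definition Z_at where "Z_at w = sol_Z k a (w $ 1 - k * w $ 3) (w $ 2 - w $ 3) (w $ 3)" for w :: "complex ^ 3"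
definition P_at where "P_at w = sol_P k a (w $ 1 - k * w $ 3) (w $ 2 - w $ 3) (w $ 3)" for w :: "complex ^ 3"

definition sol_map :: "complex ^ 3 \<Rightarrow> complex ^ 3" where
  "sol_map w = vector [k * w $ 3 + eval_fps (P_at w) 1, eval_fps (Z_at w) 1, w $ 3]"

text \<open>The integrable system in the coordinates \<open>(y / x, z / x, 1 / x\<^sup>2)\<close>,
  with the common factor \<open>x\<close> of the velocity removed.\<close>

definition linear_field :: "complex ^ 3 \<Rightarrow> complex ^ 3" where
  "linear_field w = vector [3 * w $ 1 - k * w $ 3, w $ 2 + w $ 3, 2 * w $ 3]"

definition size_at :: "complex ^ 3 \<Rightarrow> real" where
  "size_at w = size0 (w $ 1 - k * w $ 3) (w $ 2 - w $ 3) (w $ 3)"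

lemma size_at_le: "size_at w \<le> (5 + norm k) * norm w"
proof -
  have n: "norm (w $ i) \<le> norm w" for i by (rule Finite_Cartesian_Product.norm_nth_le)
  have "norm (w $ 1 - k * w $ 3) \<le> norm (w $ 1) + norm k * norm (w $ 3)"
    using norm_triangle_ineq4[of "w $ 1" "k * w $ 3"] by (simp add: norm_mult)
  also have "\<dots> \<le> norm w + norm k * norm w" by (intro add_mono mult_left_mono n) auto
  finally show ?thesis
    using norm_triangle_ineq4[of "w $ 2" "w $ 3"] n[of 2] n[of 3]
    unfolding size_at_def size0_def by (simp add: algebra_simps)
qed

lemma size_at_nonneg: "0 \<le> size_at w"
  by (simp add: size_at_def size0_def)

lemma Kbound_pos: "0 < Kbound k a"
  by (simp add: Kbound_def add_pos_nonneg)

lemma sol_map_quadratic: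
  assumes "Kbound k a * ((5 + norm k) * norm w) \<le> 1"
  shows "Kbound k a * size_at w \<le> 1"
    and "norm (sol_map w - w) \<le> 2 * (Kbound k a * (5 + norm k)\<^sup>2) * (norm w)\<^sup>2"
proof -
  have "Kbound k a * size_at w \<le> Kbound k a * ((5 + norm k) * norm w)"
    using Kbound_pos by (intro mult_left_mono size_at_le) auto
  then show s: "Kbound k a * size_at w \<le> 1" using assms by linarith
  have q: "Kbound k a * (size_at w)\<^sup>2 \<le> Kbound k a * (5 + norm k)\<^sup>2 * (norm w)\<^sup>2"
    using Kbound_pos power_mono[OF size_at_le size_at_nonneg, of w 2]
    by (simp add: power_mult_distrib mult.assoc)
  have "norm (sol_map w - w) \<le> (\<Sum>i\<in>UNIV. norm ((sol_map w - w) $ i))"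
    by (rule norm_le_sum_norm_components)
  also have "\<dots> = norm (eval_fps (P_at w) 1 - (w $ 1 - k * w $ 3))
      + norm (eval_fps (Z_at w) 1 - (w $ 2 - w $ 3 + w $ 3))"
    by (simp add: sum_3 sol_map_def algebra_simps)
  also have "\<dots> \<le> Kbound k a * (size_at w)\<^sup>2 + Kbound k a * (size_at w)\<^sup>2"
    unfolding size_at_def P_at_def Z_at_def by (intro add_mono sol_linear_part s[unfolded size_at_def])
  finally show "norm (sol_map w - w) \<le> 2 * (Kbound k a * (5 + norm k)\<^sup>2) * (norm w)\<^sup>2"
    using q by linarith
qed

text \<open>On the doubled ball the coefficients are holomorphic in \<open>w\<close> and dominated
  by a geometric series, so Weierstrass' theorem applies to the values at 1.\<close>

lemma holomorphic_sol_map: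
  assumes R: "R > 0" and small: "Kbound k a * ((5 + norm k) * (2 * R)) \<le> 1"
  shows "holomorphic_map_on sol_map (ball 0 R)"
proof -
  define b where "b = (\<lambda>n. 2 * ((5 + norm k) * (2 * R)) * (1 / 2) ^ n)"
  have "summable b" unfolding b_def by (intro summable_mult summable_geometric) simp
  have s: "Kbound k a * size_at w \<le> 1" and sb: "size_at w \<le> (5 + norm k) * (2 * R)" 
    if "w \<in> ball 0 (2 * R)" for w
  proof -
    have "(5 + norm k) * norm w \<le> (5 + norm k) * (2 * R)"
      using that by (intro mult_left_mono) auto
    then show "size_at w \<le> (5 + norm k) * (2 * R)" using size_at_le[of w] by linarith
    then show "Kbound k a * size_at w \<le> 1"
      using mult_left_mono[of "size_at w" "(5 + norm k) * (2 * R)" "Kbound k a"] Kbound_pos small by linarith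
  qed
  have c: "complex_diff_on (\<lambda>w. w $ 1 - k * w $ 3) S" "complex_diff_on (\<lambda>w. w $ 2 - w $ 3) S"
    "complex_diff_on (\<lambda>w. w $ 3) S" for S :: "(complex ^ 3) set"
    by (intro complex_diff_on_diff complex_diff_on_cmult complex_diff_on_component)+
  have sol: "complex_diff_on (\<lambda>w. fps_nth (Z_at w) n) (ball 0 (2 * R))"
    "complex_diff_on (\<lambda>w. fps_nth (P_at w) n) (ball 0 (2 * R))" for n
    using fps_diff_on_sol[OF c] unfolding fps_diff_on_def Z_at_def P_at_def by blast+
  have "norm (fps_nth (Z_at w) n) \<le> b n" "norm (fps_nth (P_at w) n) \<le> b n" if w: "w \<in> ball 0 (2 * R)" for w n
  proof -
    have "2 * size_at w * (1 / 2) ^ n \<le> b n"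
      unfolding b_def using sb[OF w] by (intro mult_right_mono mult_left_mono) auto
    moreover have "norm (fps_nth (Z_at w) n) \<le> 2 * size_at w * (1 / 2) ^ n"
      "norm (fps_nth (P_at w) n) \<le> 2 * size_at w * (1 / 2) ^ n"
      unfolding Z_at_def P_at_def size_at_def
      using psum_bounded(3)[OF psum_sol_each(1)[OF s[OF w, unfolded size_at_def]]]
        psum_bounded(3)[OF psum_sol_each(2)[OF s[OF w, unfolded size_at_def]]] by blast+
    ultimately show "norm (fps_nth (Z_at w) n) \<le> b n" "norm (fps_nth (P_at w) n) \<le> b n" by linarith+
  qed
  note bounds = this
  have sums: "complex_diff_on (\<lambda>w. \<Sum>n. fps_nth (Z_at w) n) (ball 0 R)"
    "complex_diff_on (\<lambda>w. \<Sum>n. fps_nth (P_at w) n) (ball 0 R)"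
    by (rule complex_diff_on_suminf[OF sol(1) bounds(1) \<open>summable b\<close> R]
        complex_diff_on_suminf[OF sol(2) bounds(2) \<open>summable b\<close> R], assumption)+
  have "complex_diff_on (\<lambda>w. sol_map w $ i) (ball 0 R)" for i
    using exhaust_3[of i]
  proof (elim disjE)
    assume "i = 1"
    moreover have "complex_diff_on (\<lambda>w. k * w $ 3 + (\<Sum>n. fps_nth (P_at w) n)) (ball 0 R)"
      by (intro complex_diff_on_add complex_diff_on_cmult complex_diff_on_component sums)
    ultimately show ?thesis by (simp add: sol_map_def eval_fps_def)
  next
    assume "i = 2"
    then show ?thesis using sums by (simp add: sol_map_def eval_fps_def)
  next
    assume "i = 3"
    then show ?thesis by (simp add: sol_map_def complex_diff_on_component)
  qed
  then show ?thesis by (intro holomorphic_map_onI) auto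
qed

text \<open>The linear field is the velocity at \<open>t = 1\<close> of the dilation orbit of
  \<open>w\<close>, and along that orbit \<open>sol_radial_derivative\<close> differentiates the
  map.\<close>

lemma sol_map_derivative_linear_field:
  assumes s: "Kbound k a * size_at w \<le> 1" and F': "(sol_map has_derivative F') (at w)"
  shows "F' (linear_field w) = vector
    [2 * k * w $ 3 + 3 * eval_fps (P_at w) 1 + eval_fps (fps_deriv (P_at w)) 1,
     eval_fps (Z_at w) 1 + eval_fps (fps_deriv (Z_at w)) 1, 2 * w $ 3]"
proof -
  define c r e where "c = w $ 1 - k * w $ 3" and "r = w $ 2 - w $ 3" and "e = w $ 3"
  \<comment> \<open>The orbit of \<open>w\<close> under the flow of the linear field: the
    eigencoordinates \<open>c\<close>, \<open>r\<close>, \<open>e\<close> scale by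
    \<open>t ^ 3\<close>, \<open>t\<close>, \<open>t\<^sup>2\<close>.\<close>
  define \<delta> :: "complex \<Rightarrow> complex ^ 3" where
    "\<delta> = (\<lambda>t. vector [t ^ 3 * c + k * (t\<^sup>2 * e), t * r + t\<^sup>2 * e, t\<^sup>2 * e])"
  have \<delta>1: "\<delta> 1 = w"
    by (simp add: \<delta>_def vec_eq_iff forall_3 c_def r_def e_def)
  have sol\<delta>: "Z_at (\<delta> t) = sol_Z k a (t ^ 3 * c) (t * r) (t\<^sup>2 * e)" 
    "P_at (\<delta> t) = sol_P k a (t ^ 3 * c) (t * r) (t\<^sup>2 * e)" "\<delta> t $ 3 = t\<^sup>2 * e" for t
    by (simp_all add: Z_at_def P_at_def \<delta>_def)
  have lf: "linear_field w = vector [3 * c + k * (2 * e), r + 2 * e, 2 * e]"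
    by (simp add: linear_field_def vec_eq_iff forall_3 c_def r_def e_def)
  have "(\<delta> has_derivative (\<lambda>d. \<chi> i. linear_field w $ i * d)) (at 1)"
  proof (rule has_derivative_vecI)
    fix i :: 3
    have "((\<lambda>t. t ^ 3 * c + k * (t\<^sup>2 * e)) has_field_derivative 3 * c + k * (2 * e)) (at 1)"
      "((\<lambda>t. t * r + t\<^sup>2 * e) has_field_derivative r + 2 * e) (at 1)"
      "((\<lambda>t. t\<^sup>2 * e) has_field_derivative 2 * e) (at 1)"
      by (auto intro!: derivative_eq_intros simp: algebra_simps)
    then show "((\<lambda>t. \<delta> t $ i) has_derivative (*) (linear_field w $ i)) (at 1)"
      using exhaust_3[of i] unfolding lf \<delta>_def has_field_derivative_def[symmetric] by auto
  qed
  then have D: "((\<lambda>t. sol_map (\<delta> t)) has_derivative (\<lambda>d. F' (\<chi> i. linear_field w $ i * d))) (at 1)"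
    by (rule has_derivative_compose) (use F' \<delta>1 in simp)
  have comp: "F' (linear_field w) $ i = d"
    if "((\<lambda>t. sol_map (\<delta> t) $ i) has_field_derivative d) (at 1)" for i d
  proof -
    have "((\<lambda>t. sol_map (\<delta> t) $ i) has_derivative (\<lambda>d. F' (\<chi> i. linear_field w $ i * d) $ i)) (at 1)"
      by (rule bounded_linear.has_derivative[OF bounded_linear_vec_nth D])
    from has_derivative_unique[OF this that[unfolded has_field_derivative_def]]
    have "F' (\<chi> i. linear_field w $ i * 1) $ i = d * 1" by metis
    then show ?thesis by simp
  qed
  note rad = sol_radial_derivative[OF s[unfolded size_at_def, folded c_def r_def e_def]]
  have ZP: "Z_at w = sol_Z k a c r e" "P_at w = sol_P k a c r e"
    by (simp_all add: Z_at_def P_at_def c_def r_def e_def)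
  have "((\<lambda>t. sol_map (\<delta> t) $ 1) has_field_derivative k * (2 * e) +
      (3 * eval_fps (sol_P k a c r e) 1 + eval_fps (fps_deriv (sol_P k a c r e)) 1)) (at 1)"
    unfolding sol_map_def vector_3 sol\<delta>
    by (rule DERIV_add[OF _ rad(2)]) (auto intro!: derivative_eq_intros)
  moreover have "((\<lambda>t. sol_map (\<delta> t) $ 2) has_field_derivative
      eval_fps (sol_Z k a c r e) 1 + eval_fps (fps_deriv (sol_Z k a c r e)) 1) (at 1)"
    unfolding sol_map_def vector_3 sol\<delta> by (rule rad(1))
  moreover have "((\<lambda>t. sol_map (\<delta> t) $ 3) has_field_derivative 2 * e) (at 1)"
    unfolding sol_map_def vector_3 sol\<delta> by (auto intro!: derivative_eq_intros)
  ultimately show ?thesis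
    unfolding vec_eq_iff forall_3 vector_3 ZP by (simp add: comp e_def algebra_simps)
qed

end

section \<open>The Painleve equation in the chart\<close>

text \<open>Along a solution the velocity of the chart coordinates with respect to \<open>z\<close>
  is \<open>x\<close> times this polynomial field.\<close>

definition PIV_field :: "complex \<Rightarrow> complex \<Rightarrow> complex ^ 3 \<Rightarrow> complex ^ 3" where
  "PIV_field \<theta> \<kappa> q = (let Y = q $ 1; Z = q $ 2; e = q $ 3 in vector
     [3 * Y - 3 * Y\<^sup>2 - 4 * Y * Z - 2 * \<kappa> * e + 2 * \<theta> * e * Y,
      Z + e - 2 * Y * Z - 2 * Z\<^sup>2 + 2 * \<theta> * e * Z,
      2 * e * (1 - 2 * Y - 2 * Z + 2 * \<theta> * e)])"

text \<open>The common denominator of the field: \<open>dx/dz = - x\<^sup>2 * g\<close>. It will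
  also be the rate of the new independent variable relative to \<open>z\<close>.\<close>

definition gfun :: "complex \<Rightarrow> complex ^ 3 \<Rightarrow> complex" where
  "gfun \<theta> q = 1 - 2 * q $ 1 - 2 * q $ 2 + 2 * \<theta> * q $ 3"

text \<open>By \<open>sol_ode\<close>, \<open>g\<close> times the time derivatives of the series is
  polynomial in the values, so multiplying the transported linear field by \<open>g\<close> leaves a
  polynomial identity in each component.\<close>

lemma sol_map_PIV_field:
  fixes \<theta> \<kappa> :: complex
  defines "k \<equiv> 2 * \<kappa>" and "a \<equiv> 4 * \<kappa> - 2 * \<theta>"
  assumes s: "Kbound k a * size_at k w \<le> 1" and F': "(sol_map k a has_derivative F') (at w)"
  shows "PIV_field \<theta> \<kappa> (sol_map k a w) = gfun \<theta> (sol_map k a w) *s F' (linear_field k w)"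
proof -
  define e z p z' p' where "e = w $ 3" and "z = eval_fps (Z_at k a w) 1" and "p = eval_fps (P_at k a w) 1"
    and "z' = eval_fps (fps_deriv (Z_at k a w)) 1" and "p' = eval_fps (fps_deriv (P_at k a w)) 1"
  define g where "g = gfun \<theta> (sol_map k a w)"
  have g: "g = 1 - 2 * (k * e + p) - 2 * z + 2 * \<theta> * e" "g = 1 - (2 * z + a * e + 2 * p)"
    by (simp_all add: g_def gfun_def sol_map_def e_def z_def p_def a_def k_def algebra_simps)
  have ode: "g * z' = e" "g * p' = 2 * p * z + k * (a - k) * e\<^sup>2 + 2 * a * e * p + 3 * p\<^sup>2"
    unfolding g(2) using sol_ode[OF s[unfolded size_at_def]]
    by (simp_all add: e_def z_def p_def z'_def p'_def Z_at_def P_at_def)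
  have "g * (2 * k * e + 3 * p + p') = g * (2 * k * e + 3 * p) + g * p'" by (simp add: algebra_simps)
  also have "\<dots> = 3 * (k * e + p) - 3 * (k * e + p)\<^sup>2 - 4 * (k * e + p) * z - k * e + 2 * \<theta> * e * (k * e + p)"
    unfolding ode unfolding g(1) by (simp add: a_def k_def power2_eq_square algebra_simps)
  finally have 1: "3 * (k * e + p) - 3 * (k * e + p)\<^sup>2 - 4 * (k * e + p) * z - k * e + 2 * \<theta> * e * (k * e + p)
      = g * (2 * k * e + 3 * p + p')" ..
  have "g * (z + z') = g * z + e" by (simp add: algebra_simps ode)
  also have "\<dots> = z + e - 2 * (k * e + p) * z - 2 * z\<^sup>2 + 2 * \<theta> * e * z"
    unfolding g(1) by (simp add: power2_eq_square algebra_simps)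
  finally have 2: "z + e - 2 * (k * e + p) * z - 2 * z\<^sup>2 + 2 * \<theta> * e * z = g * (z + z')" ..
  have G: "gfun \<theta> (vector [k * e + p, z, e]) = g" by (simp add: gfun_def g(1))
  show ?thesis
    unfolding sol_map_derivative_linear_field[OF s F'] g_def[symmetric] PIV_field_def Let_def
      vec_eq_iff forall_3 vector_smult_component vector_3 sol_map_def
      e_def[symmetric] z_def[symmetric] p_def[symmetric] z'_def[symmetric] p'_def[symmetric] k_def[symmetric] G
  proof (intro conjI)
    show "2 * e * (1 - 2 * (k * e + p) - 2 * z + 2 * \<theta> * e) = g * (2 * e)"
      by (simp add: g(1) algebra_simps)
  qed (fact 1 2)+
qed

lemma coords1_derivative:
  assumes x: "(x has_field_derivative - (x z)\<^sup>2 + 2 * x z * y z + 2 * x z * z - 2 * \<theta>) (at z)"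
    and y: "(y has_field_derivative - (y z)\<^sup>2 + 2 * x z * y z - 2 * y z * z - 2 * \<kappa>) (at z)"
    and x0: "x z \<noteq> 0"
  shows "((\<lambda>z. coords1 (x z) (y z) z) has_derivative
           (\<lambda>d. (d * x z) *s PIV_field \<theta> \<kappa> (coords1 (x z) (y z) z))) (at z)"
    and "- (x z)\<^sup>2 + 2 * x z * y z + 2 * x z * z - 2 * \<theta> = - (x z)\<^sup>2 * gfun \<theta> (coords1 (x z) (y z) z)"
proof -
  have "((\<lambda>z. coords1 (x z) (y z) z) has_derivative
           (\<lambda>d. \<chi> i. (x z * PIV_field \<theta> \<kappa> (coords1 (x z) (y z) z) $ i) * d)) (at z)"
  proof (rule has_derivative_vecI)
    fix i :: 3
    have "((\<lambda>z. y z / x z) has_field_derivative x z * PIV_field \<theta> \<kappa> (coords1 (x z) (y z) z) $ 1) (at z)"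
      by (rule DERIV_cong[OF DERIV_divide[OF y x x0]])
        (use x0 in \<open>simp add: PIV_field_def coords1_def divide_simps, simp add: power2_eq_square algebra_simps\<close>)
    moreover have "((\<lambda>z. z / x z) has_field_derivative x z * PIV_field \<theta> \<kappa> (coords1 (x z) (y z) z) $ 2) (at z)"
      by (rule DERIV_cong[OF DERIV_divide[OF DERIV_ident x x0]])
        (use x0 in \<open>simp add: PIV_field_def coords1_def divide_simps, simp add: power2_eq_square algebra_simps\<close>)
    moreover have "((\<lambda>z. 1 / (x z)\<^sup>2) has_field_derivative x z * PIV_field \<theta> \<kappa> (coords1 (x z) (y z) z) $ 3) (at z)"
      unfolding power2_eq_square
      by (rule DERIV_cong[OF DERIV_divide[OF DERIV_const DERIV_mult[OF x x]]])
        (use x0 in \<open>simp_all add: PIV_field_def coords1_def divide_simps\<close>,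
         simp add: power4_eq_xxxx power2_eq_square algebra_simps)
    ultimately show "((\<lambda>z. coords1 (x z) (y z) z $ i) has_derivative
        (*) (x z * PIV_field \<theta> \<kappa> (coords1 (x z) (y z) z) $ i)) (at z)"
      using exhaust_3[of i] unfolding has_field_derivative_def[symmetric] by (auto simp: coords1_def)
  qed
  moreover have "(\<lambda>d. \<chi> i. (x z * PIV_field \<theta> \<kappa> (coords1 (x z) (y z) z) $ i) * d) =
      (\<lambda>d. (d * x z) *s PIV_field \<theta> \<kappa> (coords1 (x z) (y z) z))"
    by (auto simp: vec_eq_iff mult_ac)
  ultimately show "((\<lambda>z. coords1 (x z) (y z) z) has_derivative
           (\<lambda>d. (d * x z) *s PIV_field \<theta> \<kappa> (coords1 (x z) (y z) z))) (at z)" by simp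
  show "- (x z)\<^sup>2 + 2 * x z * y z + 2 * x z * z - 2 * \<theta> = - (x z)\<^sup>2 * gfun \<theta> (coords1 (x z) (y z) z)"
    using x0 by (simp add: gfun_def coords1_def field_simps power2_eq_square)
qed

text \<open>A nonzero derivative makes \<open>zt\<close> locally invertible, and taking it as the
  variable divides all rates by \<open>g\<close>.\<close>

lemma change_of_time:
  assumes "open D" and zt: "\<And>z. z \<in> D \<Longrightarrow> (zt has_field_derivative g z) (at z)"
    and g: "\<And>z. z \<in> D \<Longrightarrow> g z \<noteq> 0"
    and x: "\<And>z. z \<in> D \<Longrightarrow> (x has_field_derivative - (x z)\<^sup>2 * g z) (at z)"
    and y: "\<And>z. z \<in> D \<Longrightarrow> (y has_field_derivative (2 * x z * y z - 2 * \<kappa>) * g z) (at z)"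
    and "z0 \<in> D"
  shows "\<exists>W. open W \<and> z0 \<in> W \<and> W \<subseteq> D \<and> inj_on zt W \<and>
     integrable_solution \<kappa> (zt ` W) (x \<circ> inv_into W zt) (y \<circ> inv_into W zt)"
proof -
  have hol: "zt holomorphic_on D"
    using zt \<open>open D\<close> by (auto simp: holomorphic_on_open)
  have "deriv zt z0 \<noteq> 0" using zt[OF \<open>z0 \<in> D\<close>] g[OF \<open>z0 \<in> D\<close>] by (simp add: DERIV_imp_deriv)
  then obtain r where r: "r > 0" "ball z0 r \<subseteq> D" "inj_on zt (ball z0 r)"
    using has_complex_derivative_locally_injective[OF hol \<open>z0 \<in> D\<close> \<open>open D\<close>] by metis
  let ?W = "ball z0 r"
  have cont: "continuous_on ?W zt"
    using holomorphic_on_imp_continuous_on[OF hol] r(2) by (rule continuous_on_subset)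
  have "open (zt ` ?W)" using cont open_ball r(3) by (rule invariance_of_domain)
  moreover have "((x \<circ> inv_into ?W zt) has_field_derivative - ((x \<circ> inv_into ?W zt) s)\<^sup>2) (at s) \<and>
      ((y \<circ> inv_into ?W zt) has_field_derivative
        2 * (x \<circ> inv_into ?W zt) s * (y \<circ> inv_into ?W zt) s - 2 * \<kappa>) (at s)"
    if s: "s \<in> zt ` ?W" for s
  proof -
    obtain z where z: "z \<in> ?W" "s = zt z" using s by blast
    then have zD: "z \<in> D" using r(2) by blast
    have inv: "inv_into ?W zt s = z" using z r(3) by simp
    have D: "(inv_into ?W zt has_field_derivative inverse (g z)) (at s)"
      unfolding z(2)
      by (rule has_field_derivative_inverse_strong[OF zt[OF zD] g[OF zD] open_ball z(1) cont]) (use r(3) in simp)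
    have "((x \<circ> inv_into ?W zt) has_field_derivative (- (x z)\<^sup>2 * g z) * inverse (g z)) (at s)"
      "((y \<circ> inv_into ?W zt) has_field_derivative ((2 * x z * y z - 2 * \<kappa>) * g z) * inverse (g z)) (at s)"
      by (intro DERIV_chain D; simp only: inv x[OF zD] y[OF zD])+
    then show ?thesis using g[OF zD] by (simp add: inv mult.assoc)
  qed
  ultimately show ?thesis
    using r unfolding integrable_solution_def by (intro exI[of _ ?W]) auto
qed

theorem proposition3p7:
  fixes \<theta>_inf \<kappa>\<^sub>0 :: complex
  shows "\<exists>(U :: (complex ^ 3) set) V \<Phi>.
           0 \<in> U \<and> biholomorphic_map U V \<Phi> \<and> \<Phi> 0 = 0 \<and>
           (\<forall>p\<in>U. \<Phi> p $ 3 = p $ 3) \<and>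
           transforms_PIV_to_integrable \<theta>_inf \<kappa>\<^sub>0 U \<Phi>"
proof -
  define k a where "k = 2 * \<kappa>\<^sub>0" and "a = 4 * \<kappa>\<^sub>0 - 2 * \<theta>_inf"
  define L B where "L = 5 + norm k" and "B = Kbound k a"
  define K where "K = 2 * (B * L\<^sup>2)"
  \<comment> \<open>One summand for each smallness condition: \<open>48 * K\<close> for
    \<open>3 * (8 * K * \<rho>) \<le> 1 / 2\<close>, \<open>4 * (B * L)\<close> for holomorphy of
    \<open>F\<close> on the ball of radius \<open>2 * \<rho>\<close>, and
    \<open>8 + 4 * norm \<theta>_inf\<close> for \<open>g \<noteq> 0\<close>. The final 1 makes the
    inequalities strict.\<close>
  define M where "M = 48 * K + 4 * (B * L) + (8 + 4 * norm \<theta>_inf) + 1"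
  define \<rho> where "\<rho> = 1 / M"
  define F where "F = sol_map k a"
  have pos: "L > 0" "B > 0" by (simp_all add: L_def B_def Kbound_pos add_pos_nonneg)
  then have pos: "L > 0" "B > 0" "K > 0" by (simp_all add: K_def)
  have "M > 0" unfolding M_def using pos by (intro add_nonneg_pos add_nonneg_nonneg) auto
  then have "\<rho> > 0" and M\<rho>: "M * \<rho> = 1" by (auto simp: \<rho>_def)
  have le: "c * \<rho> < 1" if "c < M" for c
    using mult_strict_right_mono[OF that \<open>\<rho> > 0\<close>] M\<rho> by simp
  have \<rho>K: "48 * K * \<rho> < 1" and \<rho>B: "4 * (B * L) * \<rho> < 1" and \<rho>\<theta>: "(8 + 4 * norm \<theta>_inf) * \<rho> < 1"
    using pos by (intro le; simp add: M_def add_pos_nonneg)+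
  have small: "B * (L * norm w) \<le> 1" if "w \<in> ball 0 (2 * \<rho>)" for w :: "complex ^ 3"
  proof -
    have "B * L * norm w \<le> B * L * (4 * \<rho>)"
      using that pos \<open>\<rho> > 0\<close> by (intro mult_left_mono) auto
    then show ?thesis using \<rho>B by (simp add: algebra_simps)
  qed
  have s: "B * size_at k w \<le> 1" and quad: "norm (F w - w) \<le> K * (norm w)\<^sup>2"
    if "w \<in> ball 0 (2 * \<rho>)" for w
    using sol_map_quadratic[of k a w] small[OF that] by (simp_all add: B_def L_def K_def F_def)
  have holF: "holomorphic_map_on F (ball 0 (2 * \<rho>))"
    unfolding F_def using \<rho>B \<open>\<rho> > 0\<close> by (intro holomorphic_sol_map) (auto simp: B_def L_def algebra_simps)
  define V :: "(complex ^ 3) set" where "V = ball 0 \<rho>"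
  define U where "U = F ` V"
  define \<Phi> where "\<Phi> = inv_into V F"
  have V2: "w \<in> ball 0 (2 * \<rho>)" if "w \<in> V" for w using that \<open>\<rho> > 0\<close> by (auto simp: V_def)
  have card: "real CARD(3) * (8 * K * \<rho>) \<le> 1 / 2" using \<rho>K by simp
  have quad': "\<forall>w\<in>ball 0 (2 * \<rho>). norm (F w - w) \<le> K * (norm w)\<^sup>2" using quad by blast
  note bih = near_identity_biholomorphic[OF holF \<open>\<rho> > 0\<close> quad' less_imp_le[OF pos(3)] card,
      folded V_def, folded U_def \<Phi>_def]
  have F0: "F 0 = 0" using quad[of 0] \<open>\<rho> > 0\<close> by simp
  have "0 \<in> V" using \<open>\<rho> > 0\<close> by (simp add: V_def)
  have F3: "F w $ 3 = w $ 3" for w by (simp add: F_def sol_map_def)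
  have g0: "gfun \<theta>_inf (F w) \<noteq> 0" if w: "w \<in> V" for w
  proof -
    have "norm w < \<rho>" using w by (simp add: V_def)
    have "norm (F w) \<le> norm w + K * (norm w)\<^sup>2"
      using quad[OF V2[OF w]] norm_triangle_ineq[of w "F w - w"] by simp
    also have "\<dots> \<le> \<rho> + K * \<rho>\<^sup>2"
      using \<open>norm w < \<rho>\<close> pos by (intro add_mono mult_left_mono power_mono) auto
    also have "\<dots> \<le> 2 * \<rho>"
      using mult_right_mono[of "K * \<rho>" 1 \<rho>] \<rho>K \<open>\<rho> > 0\<close> pos by (simp add: power2_eq_square mult.assoc)
    finally have F: "norm (F w) \<le> 2 * \<rho>" .
    have n: "norm (F w $ i) \<le> 2 * \<rho>" for i
      using Finite_Cartesian_Product.norm_nth_le[of "F w" i] F by linarith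
    \<comment> \<open>This is \<open>1 - g\<close>; the components of \<open>F w\<close> are at most
      \<open>2 * \<rho>\<close>, so \<open>norm h < 1\<close>.\<close>
    define h where "h = 2 * F w $ 1 + 2 * F w $ 2 - 2 * \<theta>_inf * F w $ 3"
    have "norm h \<le> 2 * norm (F w $ 1) + 2 * norm (F w $ 2) + 2 * (norm \<theta>_inf * norm (F w $ 3))"
      unfolding h_def
      by (rule order_trans[OF norm_triangle_ineq4], intro add_mono order_trans[OF norm_triangle_ineq])
        (simp_all add: norm_mult)
    also have "\<dots> \<le> 2 * (2 * \<rho>) + 2 * (2 * \<rho>) + 2 * (norm \<theta>_inf * (2 * \<rho>))"
      by (intro add_mono mult_left_mono n) auto
    also have "\<dots> < 1" using \<rho>\<theta> by (simp add: algebra_simps)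
    finally have "h \<noteq> 1" by auto
    then show ?thesis by (simp add: gfun_def h_def algebra_simps)
  qed
  have "transforms_PIV_to_integrable \<theta>_inf \<kappa>\<^sub>0 U \<Phi>"
    unfolding transforms_PIV_to_integrable_def Let_def
  proof (intro allI impI ballI)
    fix D x y z0
    assume sol: "PIV_solution \<theta>_inf \<kappa>\<^sub>0 D x y" and U: "\<forall>z\<in>D. x z \<noteq> 0 \<and> coords1 (x z) (y z) z \<in> U"
      and "z0 \<in> D"
    define q where "q = (\<lambda>z. coords1 (x z) (y z) z)"
    define g where "g = (\<lambda>z. gfun \<theta>_inf (q z))"
    let ?u = "\<lambda>z. \<Phi> (q z) $ 1 * x z" and ?v = "\<lambda>z. \<Phi> (q z) $ 2 * x z"
    have main: "(x has_field_derivative - (x z)\<^sup>2 * g z) (at z) \<and> g z \<noteq> 0 \<and>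
        (?v has_field_derivative g z) (at z) \<and>
        (?u has_field_derivative (2 * x z * ?u z - 2 * \<kappa>\<^sub>0) * g z) (at z)" if z: "z \<in> D" for z
    proof -
      have x0: "x z \<noteq> 0" using U z by blast
      have dx: "(x has_field_derivative - (x z)\<^sup>2 + 2 * x z * y z + 2 * x z * z - 2 * \<theta>_inf) (at z)"
        and dy: "(y has_field_derivative - (y z)\<^sup>2 + 2 * x z * y z - 2 * y z * z - 2 * \<kappa>\<^sub>0) (at z)"
        using sol z unfolding PIV_solution_def by blast+
      note c1 = coords1_derivative[where \<theta> = \<theta>_inf and \<kappa> = \<kappa>\<^sub>0, OF dx dy x0]
      have xg: "(x has_field_derivative - (x z)\<^sup>2 * g z) (at z)"
        using dx unfolding c1(2) by (simp add: g_def q_def)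
      obtain w where w: "w \<in> V" "q z = F w" using U z unfolding U_def q_def by blast
      have \<Phi>q: "\<Phi> (q z) = w" using bih(2)[OF w(1)] w(2) by simp
      have "q z $ 3 = 1 / (x z)\<^sup>2" by (simp add: q_def coords1_def)
      then have "w $ 3 = 1 / (x z)\<^sup>2" using F3[of w] w(2) by simp
      \<comment> \<open>The third coordinate is unchanged, so
        \<open>x\<^sup>2 * \<epsilon> = 1\<close>. This turns the terms in \<open>\<epsilon>\<close>
        of the linear field into the constants \<open>- 2 * \<kappa>\<^sub>0\<close> and 1 of the
        target equations.\<close>
      then have w3: "x z * (x z * w $ 3) = 1" using x0 by (simp add: power2_eq_square)
      have gz: "g z = gfun \<theta>_inf (F w)" by (simp add: g_def w(2))
      obtain F' where F': "(F has_derivative F') (at w)"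
        using holF V2[OF w(1)] unfolding holomorphic_map_on_def by blast
      obtain \<Phi>' where \<Phi>': "(\<Phi> has_derivative \<Phi>') (at (F w))" "\<And>c h. \<Phi>' (c *s h) = c *s \<Phi>' h"
      proof -
        have "holomorphic_map_on \<Phi> U" using bih(1) unfolding biholomorphic_map_def by blast
        moreover have "F w \<in> U" using w by (simp add: U_def)
        ultimately show thesis
          using that unfolding holomorphic_map_on_def Vector_Spaces.linear_iff by blast
      qed
      have "PIV_field \<theta>_inf \<kappa>\<^sub>0 (F w) = g z *s F' (linear_field k w)"
        unfolding gz F_def k_def a_def
        by (rule sol_map_PIV_field)
          (use s[OF V2[OF w(1)]] F' in \<open>simp_all add: F_def k_def a_def B_def\<close>)
      then have "(q has_derivative (\<lambda>d. (d * x z * g z) *s F' (linear_field k w))) (at z)"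
        using c1(1) w(2) by (simp add: q_def)
      then have "((\<lambda>z. \<Phi> (q z)) has_derivative (\<lambda>d. \<Phi>' ((d * x z * g z) *s F' (linear_field k w)))) (at z)"
        by (rule has_derivative_compose) (use \<Phi>'(1) w(2) in simp)
      \<comment> \<open>The derivative of the inverse undoes \<open>F'\<close>, so the transformed
        curve follows the linear field at rate \<open>x * g\<close>.\<close>
      then have "((\<lambda>z. \<Phi> (q z)) has_derivative (\<lambda>d. (d * x z * g z) *s linear_field k w)) (at z)"
        unfolding \<Phi>'(2) bih(3)[OF w(1) F' \<Phi>'(1)] .
      then have "((\<lambda>z. \<Phi> (q z) $ i) has_derivative
          (\<lambda>d. ((d * x z * g z) *s linear_field k w) $ i)) (at z)" for i
        by (rule bounded_linear.has_derivative[OF bounded_linear_vec_nth])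
      note vd = this
      have comp: "((\<lambda>z. \<Phi> (q z) $ i) has_field_derivative x z * g z * linear_field k w $ i) (at z)" for i
      proof -
        have "(\<lambda>d. ((d * x z * g z) *s linear_field k w) $ i) = (*) (x z * g z * linear_field k w $ i)"
          by (auto simp: mult_ac)
        then show ?thesis
          using vd[of i]
          by (simp only: has_field_derivative_def)
      qed
      \<comment> \<open>The product rule with \<open>x' = - x\<^sup>2 * g\<close> lowers the
        diagonal coefficients 3 and 1 of the linear field to 2 and 0.\<close>
      have "(?u has_field_derivative x z * g z * linear_field k w $ 1 * x z
            + (- (x z)\<^sup>2 * g z) * \<Phi> (q z) $ 1) (at z)"
        by (rule DERIV_mult[OF comp xg])
      moreover have "x z * g z * linear_field k w $ 1 * x z + (- (x z)\<^sup>2 * g z) * \<Phi> (q z) $ 1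
          = (2 * x z * ?u z - 2 * \<kappa>\<^sub>0 * (x z * (x z * w $ 3))) * g z"
        unfolding \<Phi>q by (simp add: linear_field_def k_def power2_eq_square algebra_simps)
      moreover have "(?v has_field_derivative x z * g z * linear_field k w $ 2 * x z
            + (- (x z)\<^sup>2 * g z) * \<Phi> (q z) $ 2) (at z)"
        by (rule DERIV_mult[OF comp xg])
      moreover have "x z * g z * linear_field k w $ 2 * x z + (- (x z)\<^sup>2 * g z) * \<Phi> (q z) $ 2
          = x z * (x z * w $ 3) * g z"
        unfolding \<Phi>q by (simp add: linear_field_def power2_eq_square algebra_simps)
      ultimately show ?thesis using xg g0[OF w(1)] gz by (simp add: w3)
    qed
    have "open D" using sol by (simp add: PIV_solution_def)
    have "\<exists>W. open W \<and> z0 \<in> W \<and> W \<subseteq> D \<and> inj_on ?v W \<and>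
       integrable_solution \<kappa>\<^sub>0 (?v ` W) (x \<circ> inv_into W ?v) (?u \<circ> inv_into W ?v)"
      by (rule change_of_time[OF \<open>open D\<close>, where g = g]) (use main \<open>z0 \<in> D\<close> in blast)+
    then show "\<exists>W. open W \<and> z0 \<in> W \<and> W \<subseteq> D \<and> inj_on (\<lambda>z. new_z \<Phi> (x z) (y z) z) W \<and>
       integrable_solution \<kappa>\<^sub>0 ((\<lambda>z. new_z \<Phi> (x z) (y z) z) ` W)
         (x \<circ> inv_into W (\<lambda>z. new_z \<Phi> (x z) (y z) z))
         ((\<lambda>z. new_y \<Phi> (x z) (y z) z) \<circ> inv_into W (\<lambda>z. new_z \<Phi> (x z) (y z) z))"
      by (simp add: new_y_def new_z_def q_def)
  qed
  moreover have "0 \<in> U" using F0 \<open>0 \<in> V\<close> by (metis U_def image_eqI)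
  moreover have "\<Phi> 0 = 0" using bih(2)[OF \<open>0 \<in> V\<close>] F0 by simp
  moreover have "\<forall>p\<in>U. \<Phi> p $ 3 = p $ 3"
    using bih(2) F3 by (auto simp: U_def)
  ultimately show ?thesis using bih(1) by blast
qed

end
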